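(* Let $R$ be an EPRF-TRS and $S$ be a TRS over a ranked alphabet $\Sigma$. Then it is decidable whether $\Rightarrow^*_S\subseteq\Rightarrow^*_R$ (as relations on $T_\Sigma(X)$).
   Context: A ranked alphabet $\Sigma$ is a finite set of symbols with ranks; $X=\{x_1,x_2,\dots\}$ is a countable set of variables, $T_\Sigma(X)$ the terms over $\Sigma$ and $X$, $T_\Sigma$ the ground terms. A TRS $R$ over $\Sigma$ is a finite set of rules $l\to r$, $l,r\in T_\Sigma(X)$, with every variable of $r$ occurring in $l$; $\Rightarrow_R$ is the rewrite relation, $\Rightarrow^*_R$ its reflexive transitive closure; $sign(R)$ is the set of symbols occurring in the rules. For $L\subseteq T_\Sigma$, $R^*_\Sigma(L)=\{p\mid q\Rightarrow^*_R p,\ q\in L\}$. A bottom-up tree automaton (bta) over $\Sigma$ is a finite automaton with states (treated as constants), final states, rules $\delta(a_1,\dots,a_n)\to a$ and $a\to a'$; it recognizes the ground terms rewriting to a final state. $R$ is an EPRF-TRS if for any given ranked alphabet $\Sigma\supseteq sign(R)$ and finite $L\subseteq T_\Sigma$ one can effectively construct a bta $\mathcal{C}$ over $\Sigma$ with $L(\mathcal{C})=R^*_\Sigma(L)$. *)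

theory Defs
  imports "HOL-Library.Nat_Bijection"
begin

text \<open>Kleene's schemes. \<open>computes f xs y\<close> says that \<open>f\<close>, started on the argument list \<open>xs\<close>,
  terminates with value \<open>y\<close>; a single program may be run on lists of different lengths.\<close>

datatype recf =
    Zero
  | Succ
  | Proj nat
  | Comp recf "recf list"
  | PrimRec recf recf
  | Mu recf

inductive computes :: "recf \<Rightarrow> nat list \<Rightarrow> nat \<Rightarrow> bool" where
  zero: "computes Zero xs 0"
| succ: "computes Succ (x # xs) (Suc x)"
| proj: "i < length xs \<Longrightarrow> computes (Proj i) xs (xs ! i)"
| comp: "list_all2 (\<lambda>g y. computes g xs y) gs ys \<Longrightarrow> computes f ys z
    \<Longrightarrow> computes (Comp f gs) xs z"
| primrec_0: "computes f xs y \<Longrightarrow> computes (PrimRec f g) (0 # xs) y"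
| primrec_Suc: "computes (PrimRec f g) (n # xs) y \<Longrightarrow> computes g (n # y # xs) z
    \<Longrightarrow> computes (PrimRec f g) (Suc n # xs) z"
| mu: "computes f (n # xs) 0 \<Longrightarrow> (\<And>i. i < n \<Longrightarrow> \<exists>y. computes f (i # xs) (Suc y))
    \<Longrightarrow> computes (Mu f) xs n"

primrec enc_recf :: "recf \<Rightarrow> nat" where
  "enc_recf Zero = list_encode [0]"
| "enc_recf Succ = list_encode [1]"
| "enc_recf (Proj i) = list_encode [2, i]"
| "enc_recf (Comp f gs) = list_encode [3, enc_recf f, list_encode (map enc_recf gs)]"
| "enc_recf (PrimRec f g) = list_encode [4, enc_recf f, enc_recf g]"
| "enc_recf (Mu f) = list_encode [5, enc_recf f]"

lemma computes_deterministic: "computes f xs y \<Longrightarrow> computes f xs z \<Longrightarrow> y = z"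
proof (induction f xs y arbitrary: z rule: computes.induct)
  case (zero xs)
  from zero.prems show ?case by cases auto
next
  case (succ x xs)
  from succ.prems show ?case by cases auto
next
  case (proj i xs)
  from proj.prems show ?case by cases auto
next
  case (comp xs gs ys f w)
  from comp.prems show ?case
  proof cases
    case c: (comp vs)
    then have "ys = vs"
      using comp.IH(1) by (auto simp: list_all2_conv_all_nth intro!: nth_equalityI)
    then show ?thesis using comp.IH(2) c by blast
  qed
next
  case (primrec_0 f xs y g)
  from primrec_0.prems show ?case by cases (use primrec_0.IH in blast)
next
  case (primrec_Suc f g n xs y w)
  from primrec_Suc.prems show ?case by cases (use primrec_Suc.IH in blast)
next
  case (mu f n xs)
  from mu.prems show ?case
  proof cases
    case z: mu
    show ?thesis
    proof (rule linorder_cases[of n z])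
      assume "n < z"
      then show ?thesis using z(2) mu.IH(1) by (metis nat.distinct(1))
    next
      assume "z < n"
      then show ?thesis using z(1) mu.IH(2) by (metis nat.distinct(1))
    qed
  qed
qed

datatype 'f trm = Var nat | Fun 'f "'f trm list"

primrec vars :: "'f trm \<Rightarrow> nat set" where
  "vars (Var x) = {x}"
| "vars (Fun f ts) = \<Union> (set (map vars ts))"

primrec subst :: "(nat \<Rightarrow> 'f trm) \<Rightarrow> 'f trm \<Rightarrow> 'f trm" where
  "subst \<sigma> (Var x) = \<sigma> x"
| "subst \<sigma> (Fun f ts) = Fun f (map (subst \<sigma>) ts)"

primrec syms :: "'f trm \<Rightarrow> ('f \<times> nat) set" where
  "syms (Var x) = {}"
| "syms (Fun f ts) = insert (f, length ts) (\<Union> (set (map syms ts)))"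

type_synonym alphabet = "(nat \<times> nat) set"

text \<open>\<open>(f, n) \<in> Sig\<close> means that \<open>f\<close> is a symbol of rank \<open>n\<close>; every symbol has a single rank.\<close>

definition ranked_alphabet :: "alphabet \<Rightarrow> bool" where
  "ranked_alphabet Sig \<longleftrightarrow> finite Sig \<and> single_valued Sig"

definition terms :: "alphabet \<Rightarrow> nat trm set" where
  "terms Sig = {t. syms t \<subseteq> Sig}"

definition ground_terms :: "alphabet \<Rightarrow> nat trm set" where
  "ground_terms Sig = {t \<in> terms Sig. vars t = {}}"

type_synonym 'f rules = "('f trm \<times> 'f trm) set"

definition sign :: "nat rules \<Rightarrow> alphabet" where
  "sign R = (\<Union>(l, r) \<in> R. syms l \<union> syms r)"

definition trs_over :: "alphabet \<Rightarrow> nat rules \<Rightarrow> bool" where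
  "trs_over Sig R \<longleftrightarrow> ranked_alphabet Sig \<and> finite R \<and>
     (\<forall>(l, r) \<in> R. l \<in> terms Sig \<and> r \<in> terms Sig \<and> vars r \<subseteq> vars l)"

inductive rewrite_step :: "'f rules \<Rightarrow> 'f trm \<Rightarrow> 'f trm \<Rightarrow> bool" for R where
  root: "(l, r) \<in> R \<Longrightarrow> rewrite_step R (subst \<sigma> l) (subst \<sigma> r)"
| arg: "rewrite_step R s t \<Longrightarrow> rewrite_step R (Fun f (us @ s # vs)) (Fun f (us @ t # vs))"

definition rstep :: "alphabet \<Rightarrow> nat rules \<Rightarrow> (nat trm \<times> nat trm) set" where
  "rstep Sig R = {(s, t). s \<in> terms Sig \<and> t \<in> terms Sig \<and> rewrite_step R s t}"

definition descendants :: "alphabet \<Rightarrow> nat rules \<Rightarrow> nat trm set \<Rightarrow> nat trm set" where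
  "descendants Sig R L = {p. \<exists>q \<in> L. (q, p) \<in> (rstep Sig R)\<^sup>*}"

datatype transition = Trans nat "nat list" nat | Eps nat nat

datatype bta = Bta (states: "nat set") (finals: "nat set") (transitions: "transition set")

primrec transition_over :: "alphabet \<Rightarrow> nat set \<Rightarrow> transition \<Rightarrow> bool" where
  "transition_over Sig A (Trans f as a) \<longleftrightarrow> (f, length as) \<in> Sig \<and> set as \<subseteq> A \<and> a \<in> A"
| "transition_over Sig A (Eps a b) \<longleftrightarrow> a \<in> A \<and> b \<in> A"

definition bta_over :: "alphabet \<Rightarrow> bta \<Rightarrow> bool" where
  "bta_over Sig C \<longleftrightarrow> ranked_alphabet Sig \<and> finite (states C) \<and> finals C \<subseteq> states C \<and>
     finite (transitions C) \<and> (\<forall>\<tau> \<in> transitions C. transition_over Sig (states C) \<tau>)"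

text \<open>States are constants disjoint from the alphabet, so an automaton is a rewrite system over
  the disjoint sum of alphabet symbols (\<open>Inl\<close>) and states (\<open>Inr\<close>).\<close>

definition state_const :: "nat \<Rightarrow> (nat + nat) trm" where
  "state_const a = Fun (Inr a) []"

primrec rule_of :: "transition \<Rightarrow> (nat + nat) trm \<times> (nat + nat) trm" where
  "rule_of (Trans f as a) = (Fun (Inl f) (map state_const as), state_const a)"
| "rule_of (Eps a b) = (state_const a, state_const b)"

definition lang :: "alphabet \<Rightarrow> bta \<Rightarrow> nat trm set" where
  "lang Sig C = {t \<in> ground_terms Sig. \<exists>a \<in> finals C.
     (rewrite_step (rule_of ` transitions C))\<^sup>*\<^sup>* (map_trm Inl t) (state_const a)}"

text \<open>Explicit computable codings; finite sets are coded canonically by \<open>set_encode\<close>, which is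
  injective on finite sets only. All sets coded below are finite where the codes are used.\<close>

primrec enc_term :: "nat trm \<Rightarrow> nat" where
  "enc_term (Var x) = sum_encode (Inl x)"
| "enc_term (Fun f ts) = sum_encode (Inr (prod_encode (f, list_encode (map enc_term ts))))"

definition enc_terms :: "nat trm set \<Rightarrow> nat" where
  "enc_terms L = set_encode (enc_term ` L)"

definition enc_alphabet :: "alphabet \<Rightarrow> nat" where
  "enc_alphabet Sig = set_encode (prod_encode ` Sig)"

definition enc_trs :: "nat rules \<Rightarrow> nat" where
  "enc_trs R = set_encode ((\<lambda>(l, r). prod_encode (enc_term l, enc_term r)) ` R)"

primrec enc_transition :: "transition \<Rightarrow> nat" where
  "enc_transition (Trans f as a) =
     sum_encode (Inl (prod_encode (f, prod_encode (list_encode as, a))))"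
| "enc_transition (Eps a b) = sum_encode (Inr (prod_encode (a, b)))"

definition enc_bta :: "bta \<Rightarrow> nat" where
  "enc_bta C = prod_encode (set_encode (states C),
     prod_encode (set_encode (finals C), set_encode (enc_transition ` transitions C)))"

lemma enc_recf_inject: "enc_recf f = enc_recf g \<Longrightarrow> f = g"
proof (induction f arbitrary: g)
  case (Comp f gs)
  then show ?case
    by (cases g) (auto simp: list_encode_eq intro!: list.inj_map_strong[of gs _ enc_recf enc_recf])
qed (case_tac [!] g, auto simp: list_encode_eq)

lemma enc_term_inject: "enc_term s = enc_term t \<Longrightarrow> s = t"
proof (induction s arbitrary: t)
  case (Var x)
  then show ?case by (cases t) (auto simp: sum_encode_eq)
next
  case (Fun f ss)
  then show ?case
    by (cases t)
      (auto simp: sum_encode_eq prod_encode_eq list_encode_eq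
        intro!: list.inj_map_strong[of ss _ enc_term enc_term])
qed

text \<open>``One can effectively construct'' is rendered by a program \<open>c\<close> that maps the codes of
  \<open>Sig\<close> and \<open>L\<close> to the code of an automaton. Like the informal notion, it is relative to a fixed
  \<open>R\<close>: different systems may need different programs.\<close>

definition eprf_construction :: "recf \<Rightarrow> nat rules \<Rightarrow> bool" where
  "eprf_construction c R \<longleftrightarrow>
     (\<forall>Sig L. ranked_alphabet Sig \<and> sign R \<subseteq> Sig \<and> finite L \<and> L \<subseteq> ground_terms Sig \<longrightarrow>
        (\<exists>C. bta_over Sig C \<and> lang Sig C = descendants Sig R L \<and>
             computes c [enc_alphabet Sig, enc_terms L] (enc_bta C)))"

definition eprf_trs :: "nat rules \<Rightarrow> bool" where
  "eprf_trs R \<longleftrightarrow> (\<exists>Sig. trs_over Sig R) \<and> (\<exists>c. eprf_construction c R)"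

end

theory Submission
  imports Defs
begin

text \<open>By closure under contexts and substitutions, the inclusion holds iff every rule \<open>l \<rightarrow> r\<close> of \<open>S\<close>
  satisfies \<open>l \<Rightarrow>\<^sup>* r\<close> with respect to \<open>R\<close>. Replacing the variables by fresh constants turns this into
  membership of the ground instance of \<open>r\<close> in the descendants of the singleton of the ground instance
  of \<open>l\<close>, that is, in the language of an automaton that the given program constructs.
  Since the program is itself an input, it has to be run by a universal program. Instead of
  computing, the decision procedure searches for a certificate of either answer: exactly one of the
  two answers has one, and whether a number is a certificate is decided by bounded quantification.\<close>

text \<open>Running the program, inserting the constants and coding the enlarged alphabet and the
  singleton are all functional: for valid data exactly one result has a certificate. The result can
  therefore be guessed existentially for either answer, and positive certificates suffice there. The
  only negative fact that needs evidence is that a term lies outside the language of an automaton;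
  this is why \<open>accepts\<close> and \<open>rejects\<close> are built differently from the rest.
  Codes double as bounds. \<open>enc_alphabet Sig\<close> exceeds every symbol of \<open>Sig\<close>
  and serves as the first fresh one, and \<open>enc_term l\<close> bounds the variables of a rule
  with left-hand side \<open>l\<close>. The enlarged alphabet is admissible because the given
  construction works over every ranked alphabet containing the signature of \<open>R\<close>.
  Termination of the search is claimed only for data satisfying the hypotheses; elsewhere the
  procedure may diverge.\<close>

section \<open>Computable functions over an environment\<close>

text \<open>The accessor functions in \<open>\<Gamma>\<close> play the role of the variables; the type of environments grows by
  one component whenever a quantifier is entered.\<close>

definition computable :: "('e \<Rightarrow> nat) list \<Rightarrow> ('e \<Rightarrow> nat) \<Rightarrow> bool" where
  "computable \<Gamma> f \<longleftrightarrow> (\<exists>p. \<forall>e. computes p (map (\<lambda>g. g e) \<Gamma>) (f e))"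

definition push :: "('e \<Rightarrow> nat) list \<Rightarrow> (nat \<times> 'e \<Rightarrow> nat) list" where
  "push \<Gamma> = fst # map (\<lambda>g x. g (snd x)) \<Gamma>"

lemma set_push [simp]: "set (push \<Gamma>) = insert fst ((\<lambda>g x. g (snd x)) ` set \<Gamma>)"
  by (simp add: push_def)

lemma computable_var: "f \<in> set \<Gamma> \<Longrightarrow> computable \<Gamma> f"
proof -
  assume "f \<in> set \<Gamma>"
  then obtain i where "i < length \<Gamma>" "f = \<Gamma> ! i" by (metis in_set_conv_nth)
  then have "computes (Proj i) (map (\<lambda>g. g e) \<Gamma>) (f e)" for e
    using computes.proj[of i "map (\<lambda>g. g e) \<Gamma>"] by simp
  then show ?thesis unfolding computable_def by blast
qed

text \<open>Composition, phrased as a change of environment by \<open>k\<close>. Weakening,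
  exchanging bound variables and plugging in values are all instances.\<close>

lemma computable_subst:
  assumes h: "computable \<Gamma> h" and k: "\<And>g. g \<in> set \<Gamma> \<Longrightarrow> computable \<Delta> (\<lambda>x. g (k x))"
  shows "computable \<Delta> (\<lambda>x. h (k x))"
proof -
  obtain p where p: "\<And>e. computes p (map (\<lambda>g. g e) \<Gamma>) (h e)"
    using h unfolding computable_def by blast
  obtain q where q: "\<And>g x. g \<in> set \<Gamma> \<Longrightarrow> computes (q g) (map (\<lambda>u. u x) \<Delta>) (g (k x))"
    using k unfolding computable_def by metis
  have "computes (Comp p (map q \<Gamma>)) (map (\<lambda>u. u x) \<Delta>) (h (k x))" for x
    by (rule computes.comp[OF _ p]) (auto simp: list_all2_conv_all_nth q)
  then show ?thesis unfolding computable_def by blast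
qed

lemma computable_Suc: "computable \<Gamma> f \<Longrightarrow> computable \<Gamma> (\<lambda>e. Suc (f e))"
proof -
  assume "computable \<Gamma> f"
  moreover have "computable [\<lambda>n. n] Suc"
    unfolding computable_def by (auto intro: computes.succ)
  ultimately show ?thesis using computable_subst[of "[\<lambda>n. n]" Suc \<Gamma> f] by simp
qed

lemma computable_const: "computable \<Gamma> (\<lambda>e. n)"
proof (induction n)
  case 0
  show ?case unfolding computable_def by (auto intro: computes.zero)
qed (rule computable_Suc)

text \<open>The scheme \<open>PrimRec\<close> passes \<open>n # y # xs\<close> to its step program,
  which is the argument list belonging to \<open>push (push \<Gamma>)\<close>. The counter is first
  a free variable and is then replaced by \<open>b\<close>. The arithmetic below enters through this
  lemma, after being rewritten with \<open>rec_nat\<close>.\<close>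

lemma computable_rec_nat:
  assumes a: "computable \<Gamma> a" and b: "computable \<Gamma> b"
    and h: "computable (push (push \<Gamma>)) (\<lambda>x. h (fst x) (fst (snd x)) (snd (snd x)))"
  shows "computable \<Gamma> (\<lambda>e. rec_nat (a e) (\<lambda>n y. h n y e) (b e))"
proof -
  obtain p where p: "\<And>e. computes p (map (\<lambda>g. g e) \<Gamma>) (a e)"
    using a unfolding computable_def by blast
  obtain q where q: "\<And>n y e. computes q (n # y # map (\<lambda>g. g e) \<Gamma>) (h n y e)"
    using h unfolding computable_def push_def by (auto simp: o_def)
  have "computes (PrimRec p q) (n # map (\<lambda>g. g e) \<Gamma>) (rec_nat (a e) (\<lambda>n y. h n y e) n)" for n e
    by (induction n) (auto intro: computes.intros p q)
  then have "computable (push \<Gamma>) (\<lambda>x. rec_nat (a (snd x)) (\<lambda>n y. h n y (snd x)) (fst x))"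
    unfolding computable_def push_def by (auto simp: o_def)
  then show ?thesis
    by (rule computable_subst[where k = "\<lambda>e. (b e, e)" and \<Gamma> = "push \<Gamma>" and
          h = "\<lambda>x. rec_nat (a (snd x)) (\<lambda>n y. h n y (snd x)) (fst x)", unfolded fst_conv snd_conv])
      (auto intro: computable_var b)
qed

lemma computable_snd:
  assumes "computable \<Gamma> f" shows "computable (push \<Gamma>) (\<lambda>x. f (snd x))"
  by (rule computable_subst[OF assms]) (auto intro: computable_var)

lemma computable_add:
  assumes "computable \<Gamma> f" "computable \<Gamma> g"
  shows "computable \<Gamma> (\<lambda>e. f e + g e)"
proof -
  have *: "m + n = rec_nat n (\<lambda>_. Suc) m" for m n by (induction m) auto
  show ?thesis unfolding *
    by (intro computable_rec_nat assms computable_Suc computable_var) simp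
qed

section \<open>Decidable predicates and bounded quantification\<close>

definition decidable :: "('e \<Rightarrow> nat) list \<Rightarrow> ('e \<Rightarrow> bool) \<Rightarrow> bool" where
  "decidable \<Gamma> P \<longleftrightarrow> computable \<Gamma> (\<lambda>e. of_bool (P e))"

lemma decidable_subst:
  "decidable \<Gamma> P \<Longrightarrow> (\<And>g. g \<in> set \<Gamma> \<Longrightarrow> computable \<Delta> (\<lambda>x. g (k x))) \<Longrightarrow> decidable \<Delta> (\<lambda>x. P (k x))"
  unfolding decidable_def by (rule computable_subst)

lemma computable_if:
  assumes "decidable \<Gamma> P" "computable \<Gamma> f" "computable \<Gamma> g"
  shows "computable \<Gamma> (\<lambda>e. if P e then f e else g e)"
proof -
  have *: "(if P e then f e else g e) = rec_nat (g e) (\<lambda>_ _. f e) (of_bool (P e))" for e by simp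
  show ?thesis unfolding *
    by (intro computable_rec_nat computable_snd assms assms(1)[unfolded decidable_def])
qed

lemma decidable_const: "decidable \<Gamma> (\<lambda>e. b)"
  unfolding decidable_def by (rule computable_const)

lemma decidable_not:
  assumes "decidable \<Gamma> P"
  shows "decidable \<Gamma> (\<lambda>e. \<not> P e)"
proof -
  have *: "(of_bool (\<not> b) :: nat) = (if b then 0 else 1)" for b by simp
  show ?thesis
    unfolding decidable_def * by (intro computable_if computable_const assms)
qed

lemma decidable_conj:
  assumes "decidable \<Gamma> P" "decidable \<Gamma> Q"
  shows "decidable \<Gamma> (\<lambda>e. P e \<and> Q e)"
proof -
  have *: "(of_bool (P e \<and> Q e) :: nat) = (if P e then of_bool (Q e) else 0)" for e by simp
  show ?thesis
    unfolding decidable_def *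
    by (intro computable_if computable_const assms(1) assms(2)[unfolded decidable_def])
qed

lemma decidable_disj:
  assumes "decidable \<Gamma> P" "decidable \<Gamma> Q"
  shows "decidable \<Gamma> (\<lambda>e. P e \<or> Q e)"
  using decidable_not[OF decidable_conj[OF decidable_not[OF assms(1)] decidable_not[OF assms(2)]]]
  by simp

lemma decidable_imp:
  assumes "decidable \<Gamma> P" "decidable \<Gamma> Q"
  shows "decidable \<Gamma> (\<lambda>e. P e \<longrightarrow> Q e)"
  using decidable_disj[OF decidable_not[OF assms(1)] assms(2)] by (simp only: imp_conv_disj)

lemma decidable_all_less:
  assumes b: "computable \<Gamma> b" and P: "decidable (push \<Gamma>) (\<lambda>x. P (fst x) (snd x))"
  shows "decidable \<Gamma> (\<lambda>e. \<forall>n<b e. P n e)"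
proof -
  have *: "(of_bool (\<forall>n<m. P n e) :: nat) = rec_nat 1 (\<lambda>n y. if P n e then y else 0) m" for m e
    by (induction m) (auto simp: less_Suc_eq)
  have "decidable (push (push \<Gamma>)) (\<lambda>x. P (fst x) (snd (snd x)))"
    by (rule decidable_subst[OF P, of "push (push \<Gamma>)" "\<lambda>x. (fst x, snd (snd x))",
          unfolded fst_conv snd_conv]) (auto intro: computable_var)
  moreover have "computable (push (push \<Gamma>)) (\<lambda>x. fst (snd x))" by (intro computable_var) auto
  ultimately show ?thesis unfolding decidable_def[of \<Gamma>] *
    by (intro computable_rec_nat b computable_const computable_if)
qed

lemma decidable_ex_less:
  assumes "computable \<Gamma> b" "decidable (push \<Gamma>) (\<lambda>x. P (fst x) (snd x))"
  shows "decidable \<Gamma> (\<lambda>e. \<exists>n<b e. P n e)"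
  using decidable_not[OF decidable_all_less[OF assms(1) decidable_not[OF assms(2)]]] by simp

lemma decidable_eq:
  assumes "computable \<Gamma> f" "computable \<Gamma> g"
  shows "decidable \<Gamma> (\<lambda>e. f e = g e)"
proof -
  have pred: "n - 1 = rec_nat 0 (\<lambda>m _. m) n" for n by (cases n) auto
  have diff: "m - n = rec_nat m (\<lambda>_ y. rec_nat 0 (\<lambda>m _. m) y) n" for m n
    by (induction n) (auto simp: pred[symmetric])
  have minus: "computable \<Gamma> (\<lambda>e. u e - v e)" if "computable \<Gamma> u" "computable \<Gamma> v" for u v
    unfolding diff by (intro computable_rec_nat that computable_const computable_var) auto
  have "computable \<Gamma> (\<lambda>e. (f e - g e) + (g e - f e))"
    by (intro computable_add minus assms)
  moreover have "(of_bool (m = n) :: nat) = rec_nat 1 (\<lambda>_ _. 0) ((m - n) + (n - m))" for m n :: nat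
    by (cases "(m - n) + (n - m)") auto
  ultimately show ?thesis unfolding decidable_def
    by (simp only: computable_rec_nat computable_const)
qed

lemma computable_prod_encode:
  assumes "computable \<Gamma> f" "computable \<Gamma> g"
  shows "computable \<Gamma> (\<lambda>e. prod_encode (f e, g e))"
proof -
  have *: "triangle n = rec_nat 0 (\<lambda>n y. y + Suc n) n" for n by (induction n) auto
  show ?thesis unfolding prod_encode_def prod.case *
    by (intro computable_add computable_rec_nat computable_Suc computable_const assms
        computable_var) auto
qed

lemma decidable_mem:
  assumes "computable \<Gamma> f" "computable \<Gamma> g"
  shows "decidable \<Gamma> (\<lambda>e. f e \<in> set_decode (g e))"
proof -
  have odd: "decidable \<Gamma> (\<lambda>e. odd (u e))" if "computable \<Gamma> u" for \<Gamma> :: "('b \<Rightarrow> nat) list" and u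
  proof -
    have *: "(of_bool (odd n) :: nat) = rec_nat 0 (\<lambda>_ y. of_bool (y = 0)) n" for n :: nat
      by (induction n) auto
    show ?thesis unfolding decidable_def *
      by (intro computable_rec_nat that computable_const
          decidable_eq[unfolded decidable_def] computable_var) auto
  qed
  have half: "computable \<Gamma> (\<lambda>e. u e div 2)" if "computable \<Gamma> u" for \<Gamma> :: "('b \<Rightarrow> nat) list" and u
  proof -
    have *: "n div 2 = rec_nat 0 (\<lambda>n y. y + of_bool (odd n)) n" for n :: nat
      by (induction n) auto
    show ?thesis unfolding *
      by (intro computable_rec_nat that computable_const computable_add
          odd[unfolded decidable_def] computable_var) auto
  qed
  have *: "n \<in> set_decode m \<longleftrightarrow> odd (rec_nat m (\<lambda>_ y. y div 2) n)" for m n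
  proof -
    have "m div 2 ^ n = rec_nat m (\<lambda>_ y. y div 2) n"
      by (induction n) (simp_all add: div_mult2_eq power_Suc2 del: power_Suc)
    then show ?thesis by (simp add: set_decode_def)
  qed
  show ?thesis unfolding *
    by (intro odd computable_rec_nat assms half computable_var) simp
qed

section \<open>Semidecidable predicates and unbounded search\<close>

text \<open>Monotonicity in the bound makes the class closed under conjunction and bounded universal
  quantification without any coding of tuples of witnesses.\<close>

definition semidecidable :: "('e \<Rightarrow> nat) list \<Rightarrow> ('e \<Rightarrow> bool) \<Rightarrow> bool" where
  "semidecidable \<Gamma> P \<longleftrightarrow> (\<exists>Q. decidable (push \<Gamma>) (\<lambda>x. Q (fst x) (snd x)) \<and>
     (\<forall>m n e. Q m e \<longrightarrow> m \<le> n \<longrightarrow> Q n e) \<and> (\<forall>e. P e \<longleftrightarrow> (\<exists>n. Q n e)))"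

lemma semidecidable_subst:
  assumes "semidecidable \<Gamma> P" "\<And>g. g \<in> set \<Gamma> \<Longrightarrow> computable \<Delta> (\<lambda>x. g (k x))"
  shows "semidecidable \<Delta> (\<lambda>x. P (k x))"
proof -
  obtain Q where Q: "decidable (push \<Gamma>) (\<lambda>x. Q (fst x) (snd x))"
    "\<And>m n e. Q m e \<Longrightarrow> m \<le> n \<Longrightarrow> Q n e" "\<And>e. P e \<longleftrightarrow> (\<exists>n. Q n e)"
    using assms(1) unfolding semidecidable_def by blast
  have "decidable (push \<Delta>) (\<lambda>x. Q (fst x) (k (snd x)))"
    by (rule decidable_subst[OF Q(1), of "push \<Delta>" "\<lambda>x. (fst x, k (snd x))",
          unfolded fst_conv snd_conv])
      (auto intro: computable_var computable_snd[OF assms(2)])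
  with Q(2,3) show ?thesis
    unfolding semidecidable_def by (intro exI[of _ "\<lambda>n x. Q n (k x)"]) auto
qed

lemma semidecidable_decidable: "decidable \<Gamma> P \<Longrightarrow> semidecidable \<Gamma> P"
  unfolding semidecidable_def decidable_def
  by (intro exI[of _ "\<lambda>_. P"]) (auto intro: computable_snd)

lemma semidecidable_conj:
  assumes "semidecidable \<Gamma> P" "semidecidable \<Gamma> P'"
  shows "semidecidable \<Gamma> (\<lambda>e. P e \<and> P' e)"
proof -
  obtain Q Q' where Q: "decidable (push \<Gamma>) (\<lambda>x. Q (fst x) (snd x))"
    "\<And>m n e. Q m e \<Longrightarrow> m \<le> n \<Longrightarrow> Q n e" "\<And>e. P e \<longleftrightarrow> (\<exists>n. Q n e)"
    and Q': "decidable (push \<Gamma>) (\<lambda>x. Q' (fst x) (snd x))"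
    "\<And>m n e. Q' m e \<Longrightarrow> m \<le> n \<Longrightarrow> Q' n e" "\<And>e. P' e \<longleftrightarrow> (\<exists>n. Q' n e)"
    using assms unfolding semidecidable_def by blast
  have "(P e \<and> P' e) = (\<exists>n. Q n e \<and> Q' n e)" for e
    using Q(2,3) Q'(2,3) by (metis nat_le_linear)
  then show ?thesis unfolding semidecidable_def
    using Q(2) Q'(2) decidable_conj[OF Q(1) Q'(1)]
    by (intro exI[of _ "\<lambda>n e. Q n e \<and> Q' n e"]) blast
qed

lemma semidecidable_disj:
  assumes "semidecidable \<Gamma> P" "semidecidable \<Gamma> P'"
  shows "semidecidable \<Gamma> (\<lambda>e. P e \<or> P' e)"
proof -
  obtain Q Q' where Q: "decidable (push \<Gamma>) (\<lambda>x. Q (fst x) (snd x))"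
    "\<And>m n e. Q m e \<Longrightarrow> m \<le> n \<Longrightarrow> Q n e" "\<And>e. P e \<longleftrightarrow> (\<exists>n. Q n e)"
    and Q': "decidable (push \<Gamma>) (\<lambda>x. Q' (fst x) (snd x))"
    "\<And>m n e. Q' m e \<Longrightarrow> m \<le> n \<Longrightarrow> Q' n e" "\<And>e. P' e \<longleftrightarrow> (\<exists>n. Q' n e)"
    using assms unfolding semidecidable_def by blast
  then show ?thesis unfolding semidecidable_def
    using decidable_disj[OF Q(1) Q'(1)]
    by (intro exI[of _ "\<lambda>n e. Q n e \<or> Q' n e"]) blast
qed

lemma semidecidable_ex:
  assumes "semidecidable (push \<Gamma>) (\<lambda>x. P (fst x) (snd x))"
  shows "semidecidable \<Gamma> (\<lambda>e. \<exists>k. P k e)"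
proof -
  obtain Q where Q: "decidable (push (push \<Gamma>)) (\<lambda>x. Q (fst x) (snd x))"
    "\<And>m n x. Q m x \<Longrightarrow> m \<le> n \<Longrightarrow> Q n x" "\<And>x. P (fst x) (snd x) \<longleftrightarrow> (\<exists>n. Q n x)"
    using assms unfolding semidecidable_def by blast
  \<comment> \<open>One number bounds both the witness and the evidence for it; monotonicity allows
    enlarging it until it exceeds the witness.\<close>
  have "(\<exists>k. P k e) = (\<exists>n. \<exists>k<n. Q n (k, e))" for e
  proof
    assume "\<exists>k. P k e"
    then obtain k n where "Q n (k, e)" using Q(3) by fastforce
    then have "Q (max n (Suc k)) (k, e)" using Q(2) by simp
    then show "\<exists>n. \<exists>k<n. Q n (k, e)" by (meson lessI max.cobounded2 less_le_trans)
  qed (use Q(3) in fastforce)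
  moreover have "decidable (push (push \<Gamma>)) (\<lambda>x. Q (fst (snd x)) (fst x, snd (snd x)))"
    by (rule decidable_subst[OF Q(1), of "push (push \<Gamma>)" "\<lambda>x. (fst (snd x), (fst x, snd (snd x)))",
          unfolded fst_conv snd_conv]) (auto intro: computable_var)
  then have "decidable (push \<Gamma>) (\<lambda>x. \<exists>k<fst x. Q (fst x) (k, snd x))"
    by (intro decidable_ex_less computable_var) auto
  ultimately show ?thesis unfolding semidecidable_def
    by (intro exI[of _ "\<lambda>n e. \<exists>k<n. Q n (k, e)"] conjI) (blast intro: Q(2) less_le_trans)+
qed

lemma semidecidable_all_less:
  assumes b: "computable \<Gamma> b" and P: "semidecidable (push \<Gamma>) (\<lambda>x. P (fst x) (snd x))"
  shows "semidecidable \<Gamma> (\<lambda>e. \<forall>k<b e. P k e)"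
proof -
  obtain Q where Q: "decidable (push (push \<Gamma>)) (\<lambda>x. Q (fst x) (snd x))"
    "\<And>m n x. Q m x \<Longrightarrow> m \<le> n \<Longrightarrow> Q n x" "\<And>x. P (fst x) (snd x) \<longleftrightarrow> (\<exists>n. Q n x)"
    using P unfolding semidecidable_def by blast
  have "(\<forall>k<m. P k e) \<longleftrightarrow> (\<exists>n. \<forall>k<m. Q n (k, e))" for m e
  proof (induction m)
    case (Suc m)
    show ?case
    proof
      assume *: "\<forall>k<Suc m. P k e"
      obtain n where n: "\<forall>k<m. Q n (k, e)" using * Suc by auto
      obtain n' where n': "Q n' (m, e)" using * Q(3)[of "(m, e)"] by auto
      have "\<forall>k<Suc m. Q (max n n') (k, e)"
        using n n' Q(2) by (metis less_Suc_eq max.cobounded1 max.cobounded2)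
      then show "\<exists>n. \<forall>k<Suc m. Q n (k, e)" by blast
    qed (use Q(3) in fastforce)
  qed simp
  moreover have "decidable (push (push \<Gamma>)) (\<lambda>x. Q (fst (snd x)) (fst x, snd (snd x)))"
    by (rule decidable_subst[OF Q(1), of "push (push \<Gamma>)" "\<lambda>x. (fst (snd x), (fst x, snd (snd x)))",
          unfolded fst_conv snd_conv]) (auto intro: computable_var)
  then have "decidable (push \<Gamma>) (\<lambda>x. \<forall>k<b (snd x). Q (fst x) (k, snd x))"
    by (intro decidable_all_less computable_snd b) auto
  ultimately show ?thesis unfolding semidecidable_def
    by (intro exI[of _ "\<lambda>n e. \<forall>k<b e. Q n (k, e)"] conjI) (blast intro: Q(2))+
qed

text \<open>The least \<open>n\<close> confirming \<open>P\<close> or \<open>P'\<close> is found by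
  \<open>Mu\<close>; since only one of them can be confirmed, testing \<open>Q\<close> at that
  \<open>n\<close> gives the answer. Complementarity is required at each environment separately, so
  a single \<open>d\<close> serves even if it fails at some inputs.\<close>

lemma computable_search:
  assumes "semidecidable \<Gamma> P" "semidecidable \<Gamma> P'"
  shows "\<exists>d. \<forall>e. (P' e \<longleftrightarrow> \<not> P e) \<longrightarrow> computes d (map (\<lambda>g. g e) \<Gamma>) (of_bool (P e))"
proof -
  obtain Q Q' where Q: "decidable (push \<Gamma>) (\<lambda>x. Q (fst x) (snd x))"
    "\<And>e. P e \<longleftrightarrow> (\<exists>n. Q n e)"
    and Q': "decidable (push \<Gamma>) (\<lambda>x. Q' (fst x) (snd x))"
    "\<And>e. P' e \<longleftrightarrow> (\<exists>n. Q' n e)"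
    using assms unfolding semidecidable_def by blast
  \<comment> \<open>\<open>Mu\<close> looks for a zero, hence the negation.\<close>
  obtain p where p: "\<And>n e. computes p (n # map (\<lambda>g. g e) \<Gamma>) (of_bool (\<not> (Q n e \<or> Q' n e)))"
    using decidable_not[OF decidable_disj[OF Q(1) Q'(1)]]
    unfolding decidable_def computable_def push_def by (auto simp: o_def simp del: de_Morgan_disj)
  obtain q where q: "\<And>n e. computes q (n # map (\<lambda>g. g e) \<Gamma>) (of_bool (Q n e))"
    using Q(1) unfolding decidable_def computable_def push_def by (auto simp: o_def)
  let ?pr = "map Proj [0..<length \<Gamma>]"
  have "computes (Comp q (Mu p # ?pr)) (map (\<lambda>g. g e) \<Gamma>) (of_bool (P e))"
    if "P' e \<longleftrightarrow> \<not> P e" for e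
  proof -
    define n where "n = (LEAST n. Q n e \<or> Q' n e)"
    have "\<exists>n. Q n e \<or> Q' n e" using that Q(2) Q'(2) by blast
    then have n: "Q n e \<or> Q' n e" and less: "\<And>i. i < n \<Longrightarrow> \<not> (Q i e \<or> Q' i e)"
      unfolding n_def by (metis (mono_tags, lifting) LeastI_ex, metis (mono_tags, lifting) not_less_Least)
    have "computes p (n # map (\<lambda>g. g e) \<Gamma>) 0"
      using p[of n e] n by simp
    moreover have "computes p (i # map (\<lambda>g. g e) \<Gamma>) (Suc 0)" if "i < n" for i
      using p[of i e] less[OF that] by simp
    ultimately have "computes (Mu p) (map (\<lambda>g. g e) \<Gamma>) n"
      by (blast intro: computes.mu)
    moreover have "list_all2 (\<lambda>g y. computes g (map (\<lambda>g. g e) \<Gamma>) y) ?pr (map (\<lambda>g. g e) \<Gamma>)"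
      using computes.proj[of _ "map (\<lambda>g. g e) \<Gamma>"] by (auto simp: list_all2_conv_all_nth)
    moreover have "P e \<longleftrightarrow> Q n e" using n that Q(2) Q'(2) by blast
    ultimately show ?thesis using q[of n e] by (auto intro: computes.comp)
  qed
  then show ?thesis by blast
qed

lemma computable_double: "computable \<Gamma> f \<Longrightarrow> computable \<Gamma> (\<lambda>e. 2 * f e)"
  using computable_add[of \<Gamma> f f] by (simp add: mult_2)

lemma decidable_less:
  assumes "computable \<Gamma> f" "computable \<Gamma> g"
  shows "decidable \<Gamma> (\<lambda>e. f e < g e)"
proof -
  have "decidable \<Gamma> (\<lambda>e. \<exists>k<g e. k = f e)"
    by (intro decidable_ex_less decidable_eq computable_snd assms computable_var) simp
  then show ?thesis by simp
qed

lemma computable_fst: "computable (push \<Gamma>) fst"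
  by (rule computable_var) simp

lemmas computable_intros =
  computable_const computable_Suc computable_add computable_double computable_prod_encode

lemmas decidable_intros =
  decidable_const decidable_not decidable_conj decidable_disj decidable_imp
  decidable_all_less decidable_ex_less decidable_eq decidable_less decidable_mem

lemmas semidecidable_intros =
  semidecidable_conj semidecidable_disj semidecidable_ex semidecidable_all_less
  semidecidable_decidable[OF decidable_eq] semidecidable_decidable[OF decidable_mem]
  semidecidable_decidable[OF decidable_not[OF decidable_mem]]

abbreviation projections :: "(nat \<times> nat \<times> nat \<Rightarrow> nat) list" where
  "projections \<equiv> [fst, \<lambda>x. fst (snd x), \<lambda>x. snd (snd x)]"

text \<open>Lets a ternary predicate be analysed once, on bare triples, and then be used with
  computable arguments over any environment.\<close>

lemma decidable_3:
  assumes "decidable projections (\<lambda>x. P (fst x) (fst (snd x)) (snd (snd x)))"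
    and "computable \<Gamma> a" "computable \<Gamma> b" "computable \<Gamma> c"
  shows "decidable \<Gamma> (\<lambda>e. P (a e) (b e) (c e))"
  by (rule decidable_subst[OF assms(1), of \<Gamma> "\<lambda>e. (a e, b e, c e)", unfolded fst_conv snd_conv])
    (use assms in auto)

lemma semidecidable_3:
  assumes "semidecidable projections (\<lambda>x. P (fst x) (fst (snd x)) (snd (snd x)))"
    and "computable \<Gamma> a" "computable \<Gamma> b" "computable \<Gamma> c"
  shows "semidecidable \<Gamma> (\<lambda>e. P (a e) (b e) (c e))"
  by (rule semidecidable_subst[OF assms(1), of \<Gamma> "\<lambda>e. (a e, b e, c e)", unfolded fst_conv snd_conv])
    (use assms in auto)

section \<open>Certificates\<close>

abbreviation pair :: "nat \<Rightarrow> nat \<Rightarrow> nat" where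
  "pair m n \<equiv> prod_encode (m, n)"

abbreviation cons :: "nat \<Rightarrow> nat \<Rightarrow> nat" where
  "cons x xs \<equiv> Suc (pair x xs)"

lemma mem_set_decode_less: "x \<in> set_decode W \<Longrightarrow> x < W"
proof -
  assume "x \<in> set_decode W"
  then have "W div 2 ^ x \<noteq> 0" by (auto simp: set_decode_def intro!: Nat.gr0I)
  then have "2 ^ x \<le> W" by (meson div_less not_less)
  then show ?thesis using less_exp[of x] by linarith
qed

text \<open>A finite set each of whose elements is derived by \<open>J\<close> from elements of the same set. Circular
  derivations are not excluded; the rules below are sound because their premises decrease in a
  well-founded order.\<close>

definition certified :: "(nat set \<Rightarrow> nat \<Rightarrow> bool) \<Rightarrow> nat \<Rightarrow> bool" where
  "certified J z \<longleftrightarrow> (\<exists>W. z \<in> set_decode W \<and> (\<forall>y<W. y \<notin> set_decode W \<or> J (set_decode W) y))"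

lemma certified_alt:
  "certified J z \<longleftrightarrow> (\<exists>W. z \<in> set_decode W \<and> (\<forall>y\<in>set_decode W. J (set_decode W) y))"
  unfolding certified_def using mem_set_decode_less by auto

lemma certifiedE:
  assumes "certified J z"
  obtains A where "z \<in> A" "\<forall>y\<in>A. J A y"
  using assms unfolding certified_alt by blast

text \<open>Certificates can be glued: the union of those for the premises, with \<open>z\<close>
  added, still supports itself because \<open>J\<close> is monotone in the set of available
  facts.\<close>

lemma certifiedI:
  assumes mono: "\<And>A B y. J A y \<Longrightarrow> A \<subseteq> B \<Longrightarrow> J B y"
    and V: "finite V" "\<And>y. y \<in> V \<Longrightarrow> certified J y" and J: "J V z"
  shows "certified J z"
proof -
  obtain w where w: "\<And>y. y \<in> V \<Longrightarrow> y \<in> set_decode (w y)"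
    "\<And>y x. y \<in> V \<Longrightarrow> x \<in> set_decode (w y) \<Longrightarrow> J (set_decode (w y)) x"
    using bchoice[of V "\<lambda>y W. y \<in> set_decode W \<and> (\<forall>x\<in>set_decode W. J (set_decode W) x)"] V(2)
    unfolding certified_alt by blast
  define B where "B = insert z (\<Union>y\<in>V. set_decode (w y))"
  have "finite B" unfolding B_def using V(1) by simp
  moreover have "J B x" if "x \<in> B" for x
  proof (cases "x = z")
    case True
    then show ?thesis using mono[OF J, of B] w(1) unfolding B_def by blast
  next
    case False
    with that obtain y where y: "y \<in> V" "x \<in> set_decode (w y)" unfolding B_def by blast
    show ?thesis by (rule mono[OF w(2)[OF y]]) (use y B_def in blast)
  qed
  ultimately show ?thesis
    unfolding certified_alt by (intro exI[of _ "set_encode B"]) (auto simp: B_def)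
qed

text \<open>Of the two pushed components, the inner one is the certificate \<open>W\<close> and the
  outer one the fact \<open>y\<close> under inspection.\<close>

lemma semidecidable_certified:
  assumes "semidecidable (push (push \<Gamma>)) (\<lambda>x. J (snd (snd x)) (set_decode (fst (snd x))) (fst x))"
    and "computable \<Gamma> z"
  shows "semidecidable \<Gamma> (\<lambda>e. certified (J e) (z e))"
  unfolding certified_def
  by (intro semidecidable_intros assms computable_snd) (rule computable_var, simp)+

section \<open>A universal program\<close>

abbreviation "ev f xs y \<equiv> pair 0 (pair f (pair xs y))"
abbreviation "evs gs xs ys \<equiv> pair (Suc 0) (pair gs (pair xs ys))"
abbreviation "entry xs i y \<equiv> pair 2 (pair xs (pair i y))"
abbreviation "positive f n xs \<equiv> pair 3 (pair f (pair n xs))"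

text \<open>Kleene's schemes on codes; the numbers 0 to 5 heading a program are the constructor tags
  of \<open>enc_recf\<close>. The judgements \<open>evs\<close>, \<open>entry\<close> and
  \<open>positive\<close> (successor values at all arguments below \<open>n\<close>) split premises
  about lists and the premise family of \<open>Mu\<close>, so that each rule needs at most two
  facts.\<close>

inductive run_rule :: "nat set \<Rightarrow> nat \<Rightarrow> bool" for A where
  "run_rule A (ev (cons 0 0) xs 0)"
| "run_rule A (ev (cons (Suc 0) 0) (cons x xs) (Suc x))"
| "entry xs i y \<in> A \<Longrightarrow> run_rule A (ev (cons 2 (cons i 0)) xs y)"
| "evs gs xs ys \<in> A \<Longrightarrow> ev f ys y \<in> A \<Longrightarrow> run_rule A (ev (cons 3 (cons f (cons gs 0))) xs y)"
| "ev f xs y \<in> A \<Longrightarrow> run_rule A (ev (cons 4 (cons f (cons g 0))) (cons 0 xs) y)"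
| "ev (cons 4 (cons f (cons g 0))) (cons n xs) u \<in> A \<Longrightarrow> ev g (cons n (cons u xs)) y \<in> A \<Longrightarrow>
    run_rule A (ev (cons 4 (cons f (cons g 0))) (cons (Suc n) xs) y)"
| "ev f (cons n xs) 0 \<in> A \<Longrightarrow> positive f n xs \<in> A \<Longrightarrow> run_rule A (ev (cons 5 (cons f 0)) xs n)"
| "run_rule A (evs 0 xs 0)"
| "ev g xs y \<in> A \<Longrightarrow> evs gs xs ys \<in> A \<Longrightarrow> run_rule A (evs (cons g gs) xs (cons y ys))"
| "run_rule A (entry (cons x xs) 0 x)"
| "entry xs i y \<in> A \<Longrightarrow> run_rule A (entry (cons x xs) (Suc i) y)"
| "run_rule A (positive f 0 xs)"
| "positive f n xs \<in> A \<Longrightarrow> ev f (cons n xs) (Suc y) \<in> A \<Longrightarrow> run_rule A (positive f (Suc n) xs)"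

lemma run_rule_mono: "run_rule A z \<Longrightarrow> A \<subseteq> B \<Longrightarrow> run_rule B z"
  unfolding run_rule.simps[of A] run_rule.simps[of B]
  by (elim disj_forward ex_forward conj_forward) (assumption | erule (1) subsetD[rotated])+

lemma semidecidable_run:
  assumes "computable \<Gamma> f" "computable \<Gamma> xs" "computable \<Gamma> y"
  shows "semidecidable \<Gamma> (\<lambda>e. certified run_rule (ev (f e) (xs e) (y e)))"
proof -
  have "semidecidable (push (push \<Gamma>)) (\<lambda>x. run_rule (set_decode (fst (snd x))) (fst x))" for \<Gamma> :: "('a \<Rightarrow> nat) list"
    unfolding run_rule.simps
    by (intro semidecidable_intros computable_intros; intro computable_fst computable_snd)
  then show ?thesis
    by (intro semidecidable_certified computable_intros assms)
qed

context
  fixes A assumes A: "\<And>z. z \<in> A \<Longrightarrow> run_rule A z"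
begin

lemma entry_sound: "entry xs i y \<in> A \<Longrightarrow> i < length (list_decode xs) \<and> list_decode xs ! i = y"
proof (induction i arbitrary: xs)
  case 0
  from A[OF 0] show ?case by cases auto
next
  case (Suc i)
  from A[OF Suc.prems] show ?case by cases (use Suc.IH in auto)
qed

lemma ev_sound: "ev (enc_recf f) xs y \<in> A \<Longrightarrow> computes f (list_decode xs) y"
proof (induction f arbitrary: xs y)
  case Zero
  from A[OF this] show ?case by cases (auto intro: computes.intros)
next
  case Succ
  from A[OF this] show ?case by cases (auto intro: computes.intros)
next
  case (Proj i)
  from A[OF this] show ?case by cases (auto intro: computes.intros dest!: entry_sound)
next
  case (Comp f gs)
  from A[OF Comp.prems] obtain ys where ys: "evs (list_encode (map enc_recf gs)) xs ys \<in> A"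
    "ev (enc_recf f) ys y \<in> A" by cases auto
  have "evs (list_encode (map enc_recf hs)) xs ys \<in> A \<Longrightarrow> set hs \<subseteq> set gs \<Longrightarrow>
      list_all2 (\<lambda>g y. computes g (list_decode xs) y) hs (list_decode ys)" for hs ys
  proof (induction hs arbitrary: ys)
    case Nil
    from A[OF Nil.prems(1)] show ?case by cases auto
  next
    case (Cons h hs)
    from A[OF Cons.prems(1)] show ?case
      by cases (use Cons.IH Cons.prems Comp.IH(2) in auto)
  qed
  from this[OF ys(1)] Comp.IH(1)[OF ys(2)] show ?case by (auto intro: computes.comp)
next
  case (PrimRec f g)
  have "ev (enc_recf (PrimRec f g)) (cons n zs) y \<in> A \<Longrightarrow>
      computes (PrimRec f g) (n # list_decode zs) y" for n zs y
  proof (induction n arbitrary: y)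
    case 0
    from A[OF 0] show ?case by cases (use PrimRec.IH in \<open>auto intro: computes.intros\<close>)
  next
    case (Suc n)
    from A[OF Suc.prems] show ?case
    proof cases
      case (6 f' g' m xs u y')
      then have "computes (PrimRec f g) (n # list_decode zs) u"
        by (intro Suc.IH) auto
      moreover have "computes g (list_decode (cons n (cons u zs))) y"
        using 6 by (intro PrimRec.IH(2)) auto
      ultimately show ?thesis by (auto intro: computes.primrec_Suc)
    qed auto
  qed
  moreover from A[OF PrimRec.prems] have "\<exists>n zs. xs = cons n zs"
    by cases auto
  ultimately show ?case using PrimRec.prems by auto
next
  case (Mu f)
  have pos: "positive (enc_recf f) n xs \<in> A \<Longrightarrow> i < n \<Longrightarrow> \<exists>y. computes f (i # list_decode xs) (Suc y)"
    for n i
  proof (induction n)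
    case (Suc n)
    from A[OF Suc.prems(1)] show ?case
    proof cases
      case (13 f' m xs' u)
      then have "computes f (list_decode (cons n xs)) (Suc u)" by (intro Mu.IH) auto
      then show ?thesis using 13 Suc by (auto simp: less_Suc_eq)
    qed auto
  qed simp
  from A[OF Mu.prems] show ?case
  proof cases
    case (7 f' n xs')
    then have "computes f (list_decode (cons n xs)) 0" by (intro Mu.IH) auto
    then show ?thesis using 7 pos by (auto intro: computes.mu)
  qed auto
qed

end

lemma run_iff: "certified run_rule (ev (enc_recf f) (list_encode xs) y) \<longleftrightarrow> computes f xs y"
proof
  assume "certified run_rule (ev (enc_recf f) (list_encode xs) y)"
  then obtain A where "ev (enc_recf f) (list_encode xs) y \<in> A" "\<forall>z\<in>A. run_rule A z"
    by (rule certifiedE)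
  from ev_sound[OF this(2)[rule_format] this(1)] show "computes f xs y" by simp
next
  note [intro] = run_rule.intros
  note rule = certifiedI[where J = run_rule, OF run_rule_mono]
  assume "computes f xs y"
  then show "certified run_rule (ev (enc_recf f) (list_encode xs) y)"
  proof induction
    case (zero xs)
    show ?case by (rule rule[where V = "{}"]) auto
  next
    case (succ x xs)
    show ?case by (rule rule[where V = "{}"]) auto
  next
    case (proj i xs)
    then have "certified run_rule (entry (list_encode xs) i (xs ! i))"
    proof (induction i arbitrary: xs)
      case 0
      then obtain z zs where "xs = z # zs" by (cases xs) auto
      then show ?case by (auto intro: rule[where V = "{}"])
    next
      case (Suc i)
      then obtain z zs where xs: "xs = z # zs" by (cases xs) auto
      show ?case
        by (rule rule[where V = "{entry (list_encode zs) i (zs ! i)}"]) (use Suc xs in auto)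
    qed
    then show ?case
      by (intro rule[where V = "{entry (list_encode xs) i (xs ! i)}" and
            z = "ev (enc_recf (Proj i)) (list_encode xs) (xs ! i)"]) auto
  next
    case (comp xs gs ys f z)
    from comp(1) have evs:
      "certified run_rule (evs (list_encode (map enc_recf gs)) (list_encode xs) (list_encode ys))"
    proof (induction rule: list_all2_induct)
      case Nil
      show ?case by (rule rule[where V = "{}"]) auto
    next
      case (Cons g gs y ys)
      show ?case
        by (rule rule[where V = "{ev (enc_recf g) (list_encode xs) y,
              evs (list_encode (map enc_recf gs)) (list_encode xs) (list_encode ys)}"])
          (use Cons in auto)
    qed
    show ?case
      by (rule rule[where V = "{ev (enc_recf f) (list_encode ys) z,
            evs (list_encode (map enc_recf gs)) (list_encode xs) (list_encode ys)}"])
        (use comp.IH(2) evs in auto)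
  next
    case (primrec_0 f xs y g)
    show ?case
      by (rule rule[where V = "{ev (enc_recf f) (list_encode xs) y}"]) (use primrec_0 in auto)
  next
    case (primrec_Suc f g n xs y z)
    show ?case
      by (rule rule[where V = "{ev (enc_recf (PrimRec f g)) (list_encode (n # xs)) y,
            ev (enc_recf g) (list_encode (n # y # xs)) z}"])
        (use primrec_Suc in auto)
  next
    case (mu f n xs)
    have "certified run_rule (positive (enc_recf f) m (list_encode xs))" if "m \<le> n" for m
      using that
    proof (induction m)
      case 0
      show ?case by (rule rule[where V = "{}"]) auto
    next
      case (Suc m)
      then obtain y where y: "certified run_rule (ev (enc_recf f) (list_encode (m # xs)) (Suc y))"
        using mu.IH(2) by (meson Suc_le_lessD)
      show ?case
        by (rule rule[where V = "{positive (enc_recf f) m (list_encode xs),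
              ev (enc_recf f) (list_encode (m # xs)) (Suc y)}"])
          (use y Suc in auto)
    qed
    then have pos: "certified run_rule (positive (enc_recf f) n (list_encode xs))" by simp
    show ?case
      by (rule rule[where V = "{ev (enc_recf f) (list_encode (n # xs)) 0,
            positive (enc_recf f) n (list_encode xs)}"])
        (use mu.IH(1) pos in auto)
  qed
qed

section \<open>Replacing variables by fresh constants\<close>

text \<open>\<open>sum_encode\<close> doubles a left summand and takes the successor of the double
  of a right one; so this is the code of a term headed by \<open>f\<close>, and \<open>2 * x\<close>
  is the code of \<open>Var x\<close>. The facts \<open>rel\<close> and \<open>rels\<close> serve
  again later, there relating terms to states.\<close>

abbreviation "fn f ts \<equiv> Suc (2 * pair f ts)"
abbreviation "rel s t \<equiv> pair 0 (pair s t)"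
abbreviation "rels ss ts \<equiv> pair (Suc 0) (pair ss ts)"

inductive const_rule :: "nat \<Rightarrow> nat set \<Rightarrow> nat \<Rightarrow> bool" for m A where
  "const_rule m A (rel (2 * x) (fn (m + x) 0))"
| "rels ss ts \<in> A \<Longrightarrow> const_rule m A (rel (fn f ss) (fn f ts))"
| "const_rule m A (rels 0 0)"
| "rel s t \<in> A \<Longrightarrow> rels ss ts \<in> A \<Longrightarrow> const_rule m A (rels (cons s ss) (cons t ts))"

lemma const_rule_mono: "const_rule m A z \<Longrightarrow> A \<subseteq> B \<Longrightarrow> const_rule m B z"
  unfolding const_rule.simps[of m A] const_rule.simps[of m B]
  by (elim disj_forward ex_forward conj_forward) (assumption | erule (1) subsetD[rotated])+

lemma semidecidable_const:
  assumes "computable \<Gamma> m" "computable \<Gamma> s" "computable \<Gamma> t"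
  shows "semidecidable \<Gamma> (\<lambda>e. certified (const_rule (m e)) (rel (s e) (t e)))"
proof -
  have "semidecidable projections (\<lambda>x. const_rule (fst x) (set_decode (fst (snd x))) (snd (snd x)))"
    unfolding const_rule.simps
    by (intro semidecidable_intros computable_intros;
        (intro computable_fst computable_snd)?; (rule computable_var, simp)?)
  then have "semidecidable (push (push \<Gamma>))
      (\<lambda>x. const_rule (m (snd (snd x))) (set_decode (fst (snd x))) (fst x))"
    by (rule semidecidable_3[where P = "\<lambda>m A. const_rule m (set_decode A)"])
      (intro computable_fst computable_snd assms)+
  then show ?thesis
    by (intro semidecidable_certified computable_intros assms)
qed

text \<open>These constants are fresh as soon as \<open>m\<close> exceeds every symbol of the
  alphabet; distinct variables receive distinct constants.\<close>

definition const_subst :: "nat \<Rightarrow> nat \<Rightarrow> nat trm" where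
  "const_subst m x = Fun (m + x) []"

lemma double_not_Suc_double: "2 * m \<noteq> Suc (2 * n)" for m n :: nat
  by presburger

text \<open>Each rule descends into the source term, so induction on \<open>t\<close> defeats
  circular certificates and also shows that \<open>u\<close> is unique.\<close>

lemma const_iff:
  "certified (const_rule m) (rel (enc_term t) u) \<longleftrightarrow> u = enc_term (subst (const_subst m) t)"
proof
  assume "certified (const_rule m) (rel (enc_term t) u)"
  then obtain A where "rel (enc_term t) u \<in> A" and A: "\<forall>z\<in>A. const_rule m A z"
    by (rule certifiedE)
  from this(1) show "u = enc_term (subst (const_subst m) t)"
  proof (induction t arbitrary: u)
    case (Var x)
    from A[rule_format, OF Var] show ?case
      by cases (auto simp: const_subst_def sum_encode_def double_not_Suc_double)
  next
    case (Fun f ts)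
    have *: "rels (list_encode (map enc_term ss)) us \<in> A \<Longrightarrow> set ss \<subseteq> set ts \<Longrightarrow>
        us = list_encode (map (\<lambda>t. enc_term (subst (const_subst m) t)) ss)" for ss us
    proof (induction ss arbitrary: us)
      case Nil
      from A[rule_format, OF Nil(1)] show ?case by cases auto
    next
      case (Cons s ss)
      from A[rule_format, OF Cons(2)] show ?case
        by cases (use Cons.IH Cons.prems Fun.IH in auto)
    qed
    from A[rule_format, OF Fun.prems] show ?case
    proof cases
      case (1 x)
      then show ?thesis by (simp add: sum_encode_def double_not_Suc_double[symmetric])
    next
      case (2 ss us g)
      then show ?thesis using *[of ts us] by (auto simp: sum_encode_def o_def)
    qed auto
  qed
next
  note [intro] = const_rule.intros
  note rule = certifiedI[where J = "const_rule m", OF const_rule_mono]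
  have "certified (const_rule m) (rel (enc_term t) (enc_term (subst (const_subst m) t)))"
  proof (induction t)
    case (Var x)
    show ?case
      by (rule rule[where V = "{}"]) (auto simp: const_subst_def sum_encode_def)
  next
    case (Fun f ts)
    have "certified (const_rule m) (rels (list_encode (map enc_term ss))
        (list_encode (map (\<lambda>t. enc_term (subst (const_subst m) t)) ss)))"
      if "set ss \<subseteq> set ts" for ss
      using that
    proof (induction ss)
      case Nil
      show ?case by (rule rule[where V = "{}"]) auto
    next
      case (Cons s ss)
      show ?case
        by (rule rule[where V = "{rel (enc_term s) (enc_term (subst (const_subst m) s)),
            rels (list_encode (map enc_term ss))
              (list_encode (map (\<lambda>t. enc_term (subst (const_subst m) t)) ss))}"])
          (use Cons Fun in auto)
    qed
    note rels = this[OF subset_refl]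
    show ?case
      by (rule rule[where V = "{rels (list_encode (map enc_term ts))
            (list_encode (map (\<lambda>t. enc_term (subst (const_subst m) t)) ts))}"])
        (use rels in \<open>auto simp: sum_encode_def o_def\<close>)
  qed
  then show "u = enc_term (subst (const_subst m) t) \<Longrightarrow>
      certified (const_rule m) (rel (enc_term t) u)" by simp
qed

section \<open>Bottom-up runs of a tree automaton\<close>

text \<open>Terms already containing states are included, so that the relation can be pulled back
  through the intermediate terms of a rewrite sequence.\<close>

inductive reach :: "transition set \<Rightarrow> (nat + nat) trm \<Rightarrow> nat \<Rightarrow> bool" for \<Delta> where
  state: "reach \<Delta> (state_const a) a"
| trans: "Trans f as a \<in> \<Delta> \<Longrightarrow> list_all2 (reach \<Delta>) ts as \<Longrightarrow> reach \<Delta> (Fun (Inl f) ts) a"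
| eps: "reach \<Delta> t a \<Longrightarrow> Eps a b \<in> \<Delta> \<Longrightarrow> reach \<Delta> t b"

text \<open>A chain of empty transitions leads from \<open>b\<close> to \<open>a\<close>. The last
  clause packages it, so that arguments can be exchanged for others reaching the same
  states.\<close>

lemma reach_Inl:
  assumes "reach \<Delta> (Fun (Inl f) ts) a"
  obtains as b where "Trans f as b \<in> \<Delta>" "list_all2 (reach \<Delta>) ts as"
    "\<forall>us. list_all2 (reach \<Delta>) us as \<longrightarrow> reach \<Delta> (Fun (Inl f) us) a"
proof -
  have "reach \<Delta> s a \<Longrightarrow> s = Fun (Inl f) ts \<Longrightarrow> \<exists>as b. Trans f as b \<in> \<Delta> \<and> list_all2 (reach \<Delta>) ts as \<and>
      (\<forall>us. list_all2 (reach \<Delta>) us as \<longrightarrow> reach \<Delta> (Fun (Inl f) us) a)" for s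
  proof (induction rule: reach.induct)
    case (trans g as a ss)
    have "list_all2 (reach \<Delta>) ts as"
      using trans by (auto elim: list_all2_mono)
    with trans show ?case by (auto intro: reach.trans)
  next
    case (eps t a b)
    then show ?case by (meson reach.eps)
  qed (auto simp: state_const_def)
  with assms that show ?thesis by blast
qed

text \<open>Only empty transitions apply to a state constant. The chain of them from
  \<open>q\<close> to \<open>a\<close> can be followed by any term that reaches
  \<open>q\<close>.\<close>

lemma reach_Inr:
  assumes "reach \<Delta> (Fun (Inr q) ts) a"
  shows "ts = [] \<and> (\<forall>s. reach \<Delta> s q \<longrightarrow> reach \<Delta> s a)"
proof -
  have "reach \<Delta> s a \<Longrightarrow> s = Fun (Inr q) ts \<Longrightarrow> ts = [] \<and> (\<forall>s. reach \<Delta> s q \<longrightarrow> reach \<Delta> s a)" for s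
    by (induction rule: reach.induct) (auto simp: state_const_def intro: reach.eps)
  with assms show ?thesis by blast
qed

lemma subst_state_const [simp]: "subst \<sigma> (state_const a) = state_const a"
  by (simp add: state_const_def)

lemma reach_rule:
  assumes "\<tau> \<in> \<Delta>" "reach \<Delta> (subst \<sigma> (snd (rule_of \<tau>))) a"
  shows "reach \<Delta> (subst \<sigma> (fst (rule_of \<tau>))) a"
proof (cases \<tau>)
  case (Trans f as b)
  have "list_all2 (reach \<Delta>) (map (subst \<sigma> \<circ> state_const) as) as"
    using reach.state[of \<Delta>] by (auto simp: list_all2_conv_all_nth state_const_def)
  then have "reach \<Delta> (Fun (Inl f) (map (subst \<sigma> \<circ> state_const) as)) b"
    using assms(1) Trans by (auto intro: reach.trans)
  then show ?thesis using reach_Inr[of \<Delta> b "[]" a] assms(2) Trans by (auto simp: state_const_def)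
next
  case (Eps b c)
  have "reach \<Delta> (state_const b) c"
    using assms(1) Eps by (auto intro: reach.intros)
  then show ?thesis using reach_Inr[of \<Delta> c "[]" a] assms(2) Eps by (auto simp: state_const_def)
qed

lemma reach_step:
  assumes "rewrite_step (rule_of ` \<Delta>) s t" "reach \<Delta> t a"
  shows "reach \<Delta> s a"
  using assms
proof (induction arbitrary: a)
  case (root l r \<sigma>)
  then show ?case using reach_rule[of _ \<Delta> \<sigma> a] by (metis fst_conv image_iff snd_conv)
next
  case (arg s t f us vs)
  show ?case
  proof (cases f)
    case (Inl g)
    from arg.prems[unfolded Inl] obtain as b where "list_all2 (reach \<Delta>) (us @ t # vs) as"
      and as: "\<forall>us. list_all2 (reach \<Delta>) us as \<longrightarrow> reach \<Delta> (Fun (Inl g) us) a"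
      by (rule reach_Inl)
    then obtain as' c as'' where "as = as' @ c # as''" "list_all2 (reach \<Delta>) us as'" "reach \<Delta> t c"
      "list_all2 (reach \<Delta>) vs as''" by (auto simp: list_all2_append1 list_all2_Cons1)
    then have "list_all2 (reach \<Delta>) (us @ s # vs) as"
      using arg.IH by (auto intro: list_all2_appendI)
    with as show ?thesis using Inl by blast
  next
    case (Inr q)
    then show ?thesis using reach_Inr arg.prems by blast
  qed
qed

text \<open>\<open>us\<close> holds the arguments already rewritten and grows during the
  induction.\<close>

lemma rewrite_steps_args:
  assumes "list_all2 (rewrite_step R)\<^sup>*\<^sup>* ss ts"
  shows "(rewrite_step R)\<^sup>*\<^sup>* (Fun f (us @ ss)) (Fun f (us @ ts))"
  using assms
proof (induction arbitrary: us rule: list_all2_induct)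
  case (Cons s ss t ts)
  from Cons(1) have "(rewrite_step R)\<^sup>*\<^sup>* (Fun f (us @ s # ss)) (Fun f (us @ t # ss))"
    by induction (auto intro: rtranclp.rtrancl_into_rtrancl rewrite_step.arg)
  then show ?case using Cons(3)[of "us @ [t]"] by simp
qed simp

lemma reach_rewrite_steps:
  "reach \<Delta> s a \<Longrightarrow> (rewrite_step (rule_of ` \<Delta>))\<^sup>*\<^sup>* s (state_const a)"
proof (induction rule: reach.induct)
  case (trans f as a ts)
  have "list_all2 (rewrite_step (rule_of ` \<Delta>))\<^sup>*\<^sup>* ts (map state_const as)"
    using trans(2) by (auto simp: list_all2_conv_all_nth)
  from rewrite_steps_args[OF this, of "Inl f" "[]"]
  have "(rewrite_step (rule_of ` \<Delta>))\<^sup>*\<^sup>* (Fun (Inl f) ts) (Fun (Inl f) (map state_const as))" by simp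
  also have "rewrite_step (rule_of ` \<Delta>) (Fun (Inl f) (map state_const as)) (state_const a)"
  proof -
    have "(Fun (Inl f) (map state_const as), state_const a) \<in> rule_of ` \<Delta>"
      using trans(1) by (metis image_eqI rule_of.simps(1))
    from rewrite_step.root[OF this, of Var] show ?thesis
      by (simp add: o_def)
  qed
  finally show ?case .
next
  case (eps t a b)
  have "(state_const a, state_const b) \<in> rule_of ` \<Delta>"
    using eps(2) by (metis image_eqI rule_of.simps(2))
  from rewrite_step.root[OF this, of Var] eps(3) show ?case
    by simp
qed simp

lemma rewrite_steps_state_iff:
  "(rewrite_step (rule_of ` \<Delta>))\<^sup>*\<^sup>* s (state_const a) \<longleftrightarrow> reach \<Delta> s a"
proof
  show "(rewrite_step (rule_of ` \<Delta>))\<^sup>*\<^sup>* s (state_const a) \<Longrightarrow> reach \<Delta> s a"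
    by (induction rule: converse_rtranclp_induct) (auto intro: reach.state reach_step)
qed (rule reach_rewrite_steps)

section \<open>Deciding membership by closed sets of facts\<close>

text \<open>Empty transitions may form cycles, so \<^const>\<open>certified\<close> would be unsound here. Acceptance is
  expressed instead as membership in all closed sets below a bound that exceeds every relevant fact,
  rejection as avoidance by one of them.\<close>

definition closed_facts :: "nat \<Rightarrow> nat \<Rightarrow> nat \<Rightarrow> bool" where
  "closed_facts D N W \<longleftrightarrow> rels 0 0 \<in> set_decode W \<and>
    (\<forall>t<N. \<forall>a<N. \<forall>ts<N. \<forall>as<N. rel t a \<in> set_decode W \<and> rels ts as \<in> set_decode W \<and>
      rels (cons t ts) (cons a as) < N \<longrightarrow> rels (cons t ts) (cons a as) \<in> set_decode W) \<and>
    (\<forall>f<N. \<forall>ts<N. \<forall>as<N. \<forall>a<N. 2 * pair f (pair as a) \<in> set_decode D \<and> rels ts as \<in> set_decode W \<and>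
      rel (fn f ts) a < N \<longrightarrow> rel (fn f ts) a \<in> set_decode W) \<and>
    (\<forall>t<N. \<forall>a<N. \<forall>b<N. Suc (2 * pair a b) \<in> set_decode D \<and> rel t a \<in> set_decode W \<and>
      rel t b < N \<longrightarrow> rel t b \<in> set_decode W)"

lemma decidable_closed_facts:
  assumes "computable \<Gamma> D" "computable \<Gamma> N" "computable \<Gamma> W"
  shows "decidable \<Gamma> (\<lambda>e. closed_facts (D e) (N e) (W e))"
  using _ assms
proof (rule decidable_3)
  show "decidable projections (\<lambda>x. closed_facts (fst x) (fst (snd x)) (snd (snd x)))"
    unfolding closed_facts_def
    by (intro decidable_intros computable_intros;
        (intro computable_fst computable_snd)?; (rule computable_var, simp)?)
qed

section \<open>Size bounds for codes of pairs, sets and transitions\<close>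

lemma prod_encode_mono: "a \<le> c \<Longrightarrow> b \<le> d \<Longrightarrow> pair a b \<le> pair c d"
proof -
  have "mono triangle" by (intro mono_iff_le_Suc[THEN iffD2] allI) simp
  then show "a \<le> c \<Longrightarrow> b \<le> d \<Longrightarrow> ?thesis"
    by (auto simp: prod_encode_def intro!: add_mono dest: monoD)
qed

lemma pair_leD: "pair a b \<le> n \<Longrightarrow> a \<le> n \<and> b \<le> n"
  using le_prod_encode_1[of a b] le_prod_encode_2[of b a] by linarith

lemma le_set_encode:
  assumes "finite A" "x \<in> A" shows "2 ^ x \<le> set_encode A"
  unfolding set_encode_def using assms by (intro member_le_sum) auto

lemma less_set_encode: "finite A \<Longrightarrow> x \<in> A \<Longrightarrow> x < set_encode A"
  using le_set_encode less_exp[of x] by (meson less_le_trans)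

lemma set_encode_less:
  assumes "A \<subseteq> {..<n}" shows "set_encode A < 2 ^ n"
proof -
  have "set_encode A \<le> sum ((^) 2) {..<n}"
    unfolding set_encode_def using assms by (intro sum_mono2) auto
  also have "\<dots> = 2 ^ n - 1" by (induction n) auto
  also have "\<dots> < 2 ^ n" by simp
  finally show ?thesis .
qed

text \<open>The left-hand side is the form in which \<open>closed_facts\<close> looks up a
  transition in \<open>D\<close>.\<close>

lemma enc_transition_Trans:
  "2 * pair f (pair u a) = enc_transition \<tau> \<longleftrightarrow> (\<exists>as. \<tau> = Trans f as a \<and> u = list_encode as)"
  by (cases \<tau>) (auto simp: sum_encode_def double_not_Suc_double)

lemma enc_transition_Eps: "Suc (2 * pair a b) = enc_transition \<tau> \<longleftrightarrow> \<tau> = Eps a b"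
  by (cases \<tau>) (auto simp: sum_encode_def double_not_Suc_double[symmetric])

section \<open>Closed sets contain all relevant facts, and one of them contains only true
  facts\<close>

context
  fixes \<Delta> :: "transition set" and D :: nat
  assumes fin: "finite \<Delta>" and D: "D = set_encode (enc_transition ` \<Delta>)"
begin

lemma set_decode_D: "set_decode D = enc_transition ` \<Delta>"
  using fin D by simp

lemma Trans_bounds:
  assumes "Trans f as a \<in> \<Delta>"
  shows "2 * pair f (pair (list_encode as) a) \<in> set_decode D" "f \<le> D" "list_encode as \<le> D" "a \<le> D"
proof -
  show *: "2 * pair f (pair (list_encode as) a) \<in> set_decode D"
    using assms unfolding set_decode_D by (metis enc_transition_Trans image_eqI)
  have "pair f (pair (list_encode as) a) \<le> D" using mem_set_decode_less[OF *] by simp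
  then show "f \<le> D" "list_encode as \<le> D" "a \<le> D" by (auto dest!: pair_leD)
qed

lemma Eps_bounds:
  assumes "Eps a b \<in> \<Delta>"
  shows "Suc (2 * pair a b) \<in> set_decode D" "a \<le> D" "b \<le> D"
proof -
  show *: "Suc (2 * pair a b) \<in> set_decode D"
    using assms unfolding set_decode_D by (metis enc_transition_Eps image_eqI)
  have "pair a b \<le> D" using mem_set_decode_less[OF *] by simp
  then show "a \<le> D" "b \<le> D" by (auto dest!: pair_leD)
qed

text \<open>Codes of subterms are at most \<open>r\<close>, and codes of states and state lists from
  transitions are at most \<open>D\<close>. By monotonicity of pairing, \<open>rels r D\<close>
  dominates every fact used in a run on \<open>t\<close>, so the cut-off removes none of
  them.\<close>

lemma closed_facts_complete:
  assumes closed: "closed_facts D (Suc (rels r D)) W"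
  shows "reach \<Delta> s a \<Longrightarrow> s = map_trm Inl t \<Longrightarrow> enc_term t \<le> r \<Longrightarrow> a \<le> D \<and> rel (enc_term t) a \<in> set_decode W"
proof (induction arbitrary: t rule: reach.induct)
  case (state a)
  \<comment> \<open>The image of a term under \<open>Inl\<close> is never a state constant, so this
    case is vacuous.\<close>
  then show ?case by (cases t) (auto simp: state_const_def)
next
  case (trans f as a ss)
  note bounds = Trans_bounds[OF trans(1)]
  obtain ts where t: "t = Fun f ts" and ss: "ss = map (map_trm Inl) ts"
    using trans.prems(1) by (cases t) auto
  have fts: "fn f (list_encode (map enc_term ts)) \<le> r"
    using trans.prems(2) t by (simp add: sum_encode_def)
  then have "pair f (list_encode (map enc_term ts)) \<le> r" by simp
  then have ts: "f \<le> r" "list_encode (map enc_term ts) \<le> r" by (auto dest: pair_leD)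
  have less: "n < Suc (rels r D)" if "n \<le> r \<or> n \<le> D" for n
    using that le_prod_encode_1[of r D] le_prod_encode_2[of D r]
      le_prod_encode_2[of "pair r D" "Suc 0"] by linarith
  have rels_less: "rels n m < Suc (rels r D)" if "n \<le> r" "m \<le> D" for n m
    using that by (simp add: less_Suc_eq_le prod_encode_mono)
  have rel_less: "rel n m < Suc (rels r D)" if "n \<le> r" "m \<le> D" for n m
    using that by (simp add: less_Suc_eq_le prod_encode_mono)
  have "list_all2 (\<lambda>s a. \<forall>t. s = map_trm Inl t \<longrightarrow> enc_term t \<le> r \<longrightarrow>
      a \<le> D \<and> rel (enc_term t) a \<in> set_decode W) ss as"
    using trans(2) by (rule list_all2_mono) blast
  then have "rels (list_encode (map enc_term ts)) (list_encode as) \<in> set_decode W"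
    using ss ts(2) bounds(3)
  proof (induction arbitrary: ts rule: list_all2_induct)
    case Nil
    then show ?case using closed unfolding closed_facts_def by simp
  next
    case (Cons s ss a as)
    then obtain u us where ts: "ts = u # us" "s = map_trm Inl u" "ss = map (map_trm Inl) us"
      by (cases ts) auto
    have le: "enc_term u \<le> r" "list_encode (map enc_term us) \<le> r" "a \<le> D" "list_encode as \<le> D"
      using Cons.prems(2,3) ts(1) by (auto dest!: Suc_leD pair_leD)
    have "rel (enc_term u) a \<in> set_decode W" using Cons.hyps(1) ts(2) le(1) by blast
    moreover have "rels (list_encode (map enc_term us)) (list_encode as) \<in> set_decode W"
      using Cons.IH ts(3) le by blast
    moreover have "rels (list_encode (map enc_term ts)) (list_encode (a # as)) < Suc (rels r D)"
      using Cons.prems by (intro rels_less) auto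
    ultimately show ?case
      using closed less le ts(1) unfolding closed_facts_def by simp
  qed
  then have "rel (fn f (list_encode (map enc_term ts))) a \<in> set_decode W"
    using bounds ts rel_less[OF fts bounds(4)]
    by (intro closed[unfolded closed_facts_def, THEN conjunct2, THEN conjunct2, THEN conjunct1,
          rule_format, of f _ "list_encode as"] less) auto
  then show ?case using bounds t by (simp add: sum_encode_def)
next
  case (eps s a b)
  note bounds = Eps_bounds[OF eps(2)]
  have "rel (enc_term t) a \<in> set_decode W" using eps by blast
  moreover have less: "n < Suc (rels r D)" if "n \<le> r \<or> n \<le> D" for n
    using that le_prod_encode_1[of r D] le_prod_encode_2[of D r]
      le_prod_encode_2[of "pair r D" "Suc 0"] by linarith
  moreover have "rel (enc_term t) b < Suc (rels r D)"
    using eps.prems bounds by (simp add: less_Suc_eq_le prod_encode_mono)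
  ultimately show ?case
    using bounds eps.prems
    by (auto intro!: closed[unfolded closed_facts_def, THEN conjunct2, THEN conjunct2, THEN conjunct2,
          rule_format, of _ a] less)
qed

text \<open>The witness is the set of true facts below \<open>N\<close>. The cut-off in
  \<open>closed_facts\<close> is what allows a finite set to be closed, and a subset of
  \<open>{..<N}\<close> has a code below \<open>2 ^ N\<close>.\<close>

lemma closed_facts_minimal:
  assumes "rels 0 0 < N"
  shows "\<exists>W<2 ^ N. closed_facts D N W \<and> (\<forall>t a. rel (enc_term t) a \<in> set_decode W \<longrightarrow> reach \<Delta> (map_trm Inl t) a)"
proof -
  define V where "V = {z. z < N \<and> ((\<exists>t a. z = rel (enc_term t) a \<and> reach \<Delta> (map_trm Inl t) a) \<or>
    (\<exists>ts as. z = rels (list_encode (map enc_term ts)) (list_encode as) \<and>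
      list_all2 (reach \<Delta>) (map (map_trm Inl) ts) as))}"
  have V: "finite V" "set_encode V < 2 ^ N"
    by (auto simp: V_def intro!: set_encode_less)
  have rel: "rel u a \<in> V \<longleftrightarrow> rel u a < N \<and> (\<exists>t. u = enc_term t \<and> reach \<Delta> (map_trm Inl t) a)" for u a
    unfolding V_def by auto
  have rels: "rels us v \<in> V \<longleftrightarrow> rels us v < N \<and> (\<exists>ts as. us = list_encode (map enc_term ts) \<and>
      v = list_encode as \<and> list_all2 (reach \<Delta>) (map (map_trm Inl) ts) as)" for us v
    unfolding V_def by auto
  have "closed_facts D N (set_encode V)"
    unfolding closed_facts_def set_encode_inverse[OF V(1)]
  proof (intro conjI allI impI; (elim conjE)?)
    show "rels 0 0 \<in> V" using assms unfolding rels by (auto intro!: exI[of _ "[]"])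
  next
    fix t a ts as
    assume "rel t a \<in> V" "rels ts as \<in> V" "rels (cons t ts) (cons a as) < N"
    moreover from this obtain u us bs where "t = enc_term u" "reach \<Delta> (map_trm Inl u) a"
      "ts = list_encode (map enc_term us)" "as = list_encode bs"
      "list_all2 (reach \<Delta>) (map (map_trm Inl) us) bs" unfolding rel rels by auto
    ultimately show "rels (cons t ts) (cons a as) \<in> V"
      unfolding rels by (auto intro!: exI[of _ "u # us"] exI[of _ "a # bs"])
  next
    fix f ts as a
    assume *: "2 * pair f (pair as a) \<in> set_decode D" "rels ts as \<in> V" "rel (fn f ts) a < N"
    then obtain us bs where "ts = list_encode (map enc_term us)" "as = list_encode bs"
      "list_all2 (reach \<Delta>) (map (map_trm Inl) us) bs" unfolding rels by auto
    moreover from this * have "Trans f bs a \<in> \<Delta>"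
      unfolding set_decode_D by (auto simp: enc_transition_Trans list_encode_eq)
    ultimately show "rel (fn f ts) a \<in> V"
      using * unfolding rel by (auto intro!: exI[of _ "Fun f us"] reach.trans simp: sum_encode_def)
  next
    fix t a b
    assume "Suc (2 * pair a b) \<in> set_decode D" "rel t a \<in> V" "rel t b < N"
    then show "rel t b \<in> V"
      unfolding rel set_decode_D by (auto simp: enc_transition_Eps) (blast intro: reach.eps)
  qed
  moreover have "reach \<Delta> (map_trm Inl t) a" if "rel (enc_term t) a \<in> V" for t a
    using that unfolding rel by (auto dest: enc_term_inject)
  ultimately show ?thesis using V by (intro exI[of _ "set_encode V"]) auto
qed

end

text \<open>With \<open>N = Suc (rels r D)\<close>, the membership of \<open>N\<close> in
  \<open>set_decode B\<close> forces \<open>2 ^ N \<le> B\<close>. Hence \<open>W<B\<close> covers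
  all subsets of \<open>{..<N}\<close>, the quantifier over \<open>W\<close> is bounded, and no
  exponential has to be computed. The bound \<open>a<F\<close> loses nothing, as elements of a
  decoded set are smaller than its code.\<close>

definition accepts :: "nat \<Rightarrow> nat \<Rightarrow> nat \<Rightarrow> bool" where
  "accepts F D r \<longleftrightarrow> (\<exists>B. Suc (rels r D) \<in> set_decode B \<and>
    (\<forall>W<B. closed_facts D (Suc (rels r D)) W \<longrightarrow> (\<exists>a<F. a \<in> set_decode F \<and> rel r a \<in> set_decode W)))"

definition rejects :: "nat \<Rightarrow> nat \<Rightarrow> nat \<Rightarrow> bool" where
  "rejects F D r \<longleftrightarrow> (\<exists>W. closed_facts D (Suc (rels r D)) W \<and>
    \<not> (\<exists>a<F. a \<in> set_decode F \<and> rel r a \<in> set_decode W))"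

lemma semidecidable_accepts:
  assumes "computable \<Gamma> F" "computable \<Gamma> D" "computable \<Gamma> r"
  shows "semidecidable \<Gamma> (\<lambda>e. accepts (F e) (D e) (r e))"
  using _ assms
proof (rule semidecidable_3)
  show "semidecidable projections (\<lambda>x. accepts (fst x) (fst (snd x)) (snd (snd x)))"
    unfolding accepts_def
    by (intro semidecidable_ex semidecidable_decidable decidable_closed_facts
          decidable_intros computable_intros;
        (intro computable_fst computable_snd)?; (rule computable_var, simp)?)
qed

lemma semidecidable_rejects:
  assumes "computable \<Gamma> F" "computable \<Gamma> D" "computable \<Gamma> r"
  shows "semidecidable \<Gamma> (\<lambda>e. rejects (F e) (D e) (r e))"
  using _ assms
proof (rule semidecidable_3)
  show "semidecidable projections (\<lambda>x. rejects (fst x) (fst (snd x)) (snd (snd x)))"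
    unfolding rejects_def
    by (intro semidecidable_ex semidecidable_decidable decidable_closed_facts
          decidable_intros computable_intros;
        (intro computable_fst computable_snd)?; (rule computable_var, simp)?)
qed

text \<open>If a final state is reached, completeness puts such a fact into every closed set.
  Otherwise the minimal closed set has none; it refutes acceptance because its code lies below every
  admissible \<open>B\<close>, and it is itself a witness for rejection.\<close>

lemma accepts_rejects_iff:
  assumes "finite \<Delta>" "finite F"
  shows "accepts (set_encode F) (set_encode (enc_transition ` \<Delta>)) (enc_term t) \<longleftrightarrow>
      (\<exists>a\<in>F. reach \<Delta> (map_trm Inl t) a)" (is "?A \<longleftrightarrow> ?P")
    and "rejects (set_encode F) (set_encode (enc_transition ` \<Delta>)) (enc_term t) \<longleftrightarrow>
      \<not> (\<exists>a\<in>F. reach \<Delta> (map_trm Inl t) a)" (is "?R \<longleftrightarrow> _")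
proof -
  define D where D: "D = set_encode (enc_transition ` \<Delta>)"
  define N where "N = Suc (rels (enc_term t) D)"
  have F: "(\<exists>a<set_encode F. a \<in> set_decode (set_encode F) \<and> Q a) \<longleftrightarrow> (\<exists>a\<in>F. Q a)" for Q
    using less_set_encode[OF assms(2)] assms(2) by auto
  have complete: "\<exists>a\<in>F. rel (enc_term t) a \<in> set_decode W" if "?P" "closed_facts D N W" for W
    using closed_facts_complete[OF assms(1) D] that unfolding N_def by blast
  have "rels 0 0 < N" unfolding N_def by (simp add: less_Suc_eq_le prod_encode_mono)
  then obtain W where W: "W < 2 ^ N" "closed_facts D N W"
    "\<And>a. rel (enc_term t) a \<in> set_decode W \<Longrightarrow> reach \<Delta> (map_trm Inl t) a"
    using closed_facts_minimal[OF assms(1) D] by blast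
  have big: "2 ^ N \<le> B" if "N \<in> set_decode B" for B
    using le_set_encode[OF finite_set_decode that] by simp
  have A: "?A \<longleftrightarrow> (\<exists>B. N \<in> set_decode B \<and> (\<forall>W<B. closed_facts D N W \<longrightarrow>
      (\<exists>a\<in>F. rel (enc_term t) a \<in> set_decode W)))"
    unfolding accepts_def F D[symmetric] N_def[symmetric] ..
  \<comment> \<open>Supplies an admissible \<open>B\<close>, namely \<open>2 ^ N\<close>.\<close>
  have "N \<in> set_decode (set_encode {N})" by (subst set_encode_inverse) auto
  then show "?A \<longleftrightarrow> ?P"
    unfolding A using complete W big by (meson less_le_trans)
  have R: "?R \<longleftrightarrow> (\<exists>W. closed_facts D N W \<and> \<not> (\<exists>a\<in>F. rel (enc_term t) a \<in> set_decode W))"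
    unfolding rejects_def F D[symmetric] N_def[symmetric] ..
  show "?R \<longleftrightarrow> \<not> ?P"
    unfolding R using complete W by blast
qed

section \<open>Reduction to ground reachability\<close>

lemma subst_cong: "(\<And>x. x \<in> vars t \<Longrightarrow> \<sigma> x = \<tau> x) \<Longrightarrow> subst \<sigma> t = subst \<tau> t"
  by (induction t) auto

lemma subst_Var [simp]: "subst Var t = t"
  by (induction t) (auto intro: map_idI)

lemma subst_subst: "subst \<tau> (subst \<sigma> t) = subst (\<lambda>x. subst \<tau> (\<sigma> x)) t"
  by (induction t) auto

lemma syms_subst: "syms (subst \<sigma> t) = syms t \<union> (\<Union>x\<in>vars t. syms (\<sigma> x))"
  by (induction t) auto

lemma vars_subst: "vars (subst \<sigma> t) = (\<Union>x\<in>vars t. vars (\<sigma> x))"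
  by (induction t) auto

lemma rewrite_step_subst: "rewrite_step R s t \<Longrightarrow> rewrite_step R (subst \<sigma> s) (subst \<sigma> t)"
  by (induction rule: rewrite_step.induct) (auto simp: subst_subst intro: rewrite_step.intros)

text \<open>Two alphabets are allowed because the lemma serves twice: with equal ones to simulate a
  rule of \<open>S\<close>, and with the extended one to insert constants.\<close>

lemma rstep_star_subst:
  assumes "(s, t) \<in> (rstep Sig R)\<^sup>*" "Sig \<subseteq> Sig'" "\<And>x. \<sigma> x \<in> terms Sig'"
  shows "(subst \<sigma> s, subst \<sigma> t) \<in> (rstep Sig' R)\<^sup>*"
  using assms(1)
proof induction
  case (step t u)
  have "(subst \<sigma> t, subst \<sigma> u) \<in> rstep Sig' R"
    using step(2) assms(2,3) rewrite_step_subst[of R t u \<sigma>]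
    by (fastforce simp: rstep_def terms_def syms_subst)
  with step(3) show ?case by simp
qed simp

lemma rstep_star_arg:
  assumes "(s, t) \<in> (rstep Sig R)\<^sup>*" "Fun f (us @ s # vs) \<in> terms Sig"
  shows "(Fun f (us @ s # vs), Fun f (us @ t # vs)) \<in> (rstep Sig R)\<^sup>*"
  using assms(1)
proof induction
  case (step t u)
  have "(Fun f (us @ t # vs), Fun f (us @ u # vs)) \<in> rstep Sig R"
    using step(2) assms(2) by (auto simp: rstep_def terms_def intro: rewrite_step.arg)
  with step(3) show ?case by simp
qed simp

lemma rewrite_step_simulation:
  assumes S: "\<And>l r. (l, r) \<in> S \<Longrightarrow> (l, r) \<in> (rstep Sig R)\<^sup>* \<and> vars r \<subseteq> vars l"
  shows "rewrite_step S s t \<Longrightarrow> s \<in> terms Sig \<Longrightarrow> (s, t) \<in> (rstep Sig R)\<^sup>*"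
proof (induction rule: rewrite_step.induct)
  case (root l r \<sigma>)
  \<comment> \<open>Outside \<open>vars l\<close> the matching substitution may leave
    \<open>terms Sig\<close>; a variable belongs to every such set. The right-hand side is
    unaffected because its variables occur in \<open>l\<close>.\<close>
  define \<tau> where "\<tau> = (\<lambda>x. if x \<in> vars l then \<sigma> x else Var 0)"
  have "subst \<sigma> l = subst \<tau> l" "subst \<sigma> r = subst \<tau> r"
    using S[OF root(1)] by (auto simp: \<tau>_def intro!: subst_cong)
  moreover have "\<tau> x \<in> terms Sig" for x
    using root(2) by (auto simp: \<tau>_def terms_def syms_subst)
  ultimately show ?case using rstep_star_subst S[OF root(1)] by (metis order_refl)
next
  case (arg s t f us vs)
  then have "s \<in> terms Sig" by (auto simp: terms_def)
  then show ?case using arg by (intro rstep_star_arg) auto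
qed

lemma rstep_star_subset_iff:
  assumes "trs_over Sig S"
  shows "(rstep Sig S)\<^sup>* \<subseteq> (rstep Sig R)\<^sup>* \<longleftrightarrow> (\<forall>(l, r)\<in>S. (l, r) \<in> (rstep Sig R)\<^sup>*)"
proof
  assume *: "(rstep Sig S)\<^sup>* \<subseteq> (rstep Sig R)\<^sup>*"
  show "\<forall>(l, r)\<in>S. (l, r) \<in> (rstep Sig R)\<^sup>*"
  proof safe
    fix l r assume lr: "(l, r) \<in> S"
    have "(l, r) \<in> rstep Sig S"
      using rewrite_step.root[OF lr, of Var] lr assms by (auto simp: rstep_def trs_over_def)
    with * show "(l, r) \<in> (rstep Sig R)\<^sup>*" by blast
  qed
next
  assume *: "\<forall>(l, r)\<in>S. (l, r) \<in> (rstep Sig R)\<^sup>*"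
  have "rstep Sig S \<subseteq> (rstep Sig R)\<^sup>*"
  proof safe
    fix s t assume "(s, t) \<in> rstep Sig S"
    then show "(s, t) \<in> (rstep Sig R)\<^sup>*"
      using * assms by (intro rewrite_step_simulation[of S]) (auto simp: rstep_def trs_over_def)
  qed
  then show "(rstep Sig S)\<^sup>* \<subseteq> (rstep Sig R)\<^sup>*"
    by (rule rtrancl_subset_rtrancl)
qed

text \<open>An alphabet must be finite, so constants are added only for variables up to a bound
  \<open>k\<close>, later the code of a left-hand side.\<close>

definition extend :: "alphabet \<Rightarrow> nat \<Rightarrow> nat \<Rightarrow> alphabet" where
  "extend Sig m k = Sig \<union> (\<lambda>x. (m + x, 0)) ` {..k}"

fun unconst :: "nat \<Rightarrow> nat trm \<Rightarrow> nat trm" where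
  "unconst m (Var x) = Var x"
| "unconst m (Fun f ts) = (if m \<le> f then Var (f - m) else Fun f (map (unconst m) ts))"

text \<open>Fresh symbols cannot occur in \<open>t\<close>, so \<open>unconst\<close> acts on the
  substitution alone. Applied to both sides of a rule of \<open>R\<close>, this turns an instance of
  the rule into another instance of it.\<close>

lemma unconst_subst:
  assumes "\<And>f n. (f, n) \<in> Sig \<Longrightarrow> f < m" "t \<in> terms Sig"
  shows "unconst m (subst \<sigma> t) = subst (\<lambda>x. unconst m (\<sigma> x)) t"
  using assms(2)
proof (induction t)
  case (Fun f ts)
  then have "f < m" using assms(1)[of f] by (auto simp: terms_def)
  moreover have "\<forall>t\<in>set ts. t \<in> terms Sig" using Fun.prems by (auto simp: terms_def)
  ultimately show ?case using Fun.IH by auto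
qed simp

lemma unconst_const_subst:
  assumes "\<And>f n. (f, n) \<in> Sig \<Longrightarrow> f < m" "t \<in> terms Sig"
  shows "unconst m (subst (const_subst m) t) = t"
  using unconst_subst[OF assms, where \<sigma> = "const_subst m"] by (simp add: const_subst_def)

lemma unconst_terms:
  assumes "t \<in> terms (extend Sig m k)"
  shows "unconst m t \<in> terms Sig"
  using assms
proof (induction t)
  case (Fun f ts)
  have "unconst m t \<in> terms Sig" if "t \<in> set ts" for t
    using Fun that by (auto simp: terms_def)
  moreover have "(f, length ts) \<in> Sig" if "f < m"
    using Fun.prems that by (auto simp: terms_def extend_def)
  ultimately show ?case by (auto simp: terms_def)
qed (simp add: terms_def)

text \<open>The equality covers a step inside the arguments of a symbol from \<open>m\<close>
  upwards, which \<open>unconst\<close> discards. It can arise because \<open>s\<close> and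
  \<open>t\<close> are not restricted to the extended alphabet, where such symbols are
  constants.\<close>

lemma unconst_rewrite_step:
  assumes "\<And>f n. (f, n) \<in> Sig \<Longrightarrow> f < m" "trs_over Sig R"
  shows "rewrite_step R s t \<Longrightarrow> unconst m s = unconst m t \<or> rewrite_step R (unconst m s) (unconst m t)"
proof (induction rule: rewrite_step.induct)
  case (root l r \<sigma>)
  then have "l \<in> terms Sig" "r \<in> terms Sig" using assms(2) by (auto simp: trs_over_def)
  then show ?case using unconst_subst[OF assms(1), where \<sigma> = \<sigma>] root by (auto intro: rewrite_step.root)
qed (auto intro: rewrite_step.arg)

lemma rstep_star_const_subst_iff:
  assumes fresh: "\<And>f n. (f, n) \<in> Sig \<Longrightarrow> f < m" and R: "trs_over Sig R"
    and "s \<in> terms Sig" "t \<in> terms Sig" and k: "vars s \<subseteq> {..k}" "vars t \<subseteq> {..k}"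
  shows "(subst (const_subst m) s, subst (const_subst m) t) \<in> (rstep (extend Sig m k) R)\<^sup>* \<longleftrightarrow>
    (s, t) \<in> (rstep Sig R)\<^sup>*"
proof
  assume *: "(s, t) \<in> (rstep Sig R)\<^sup>*"
  \<comment> \<open>Capping at \<open>k\<close> keeps every value inside the extended alphabet, as
    \<open>rstep_star_subst\<close> demands, and changes nothing on the variables of
    \<open>s\<close> and \<open>t\<close>.\<close>
  let ?\<sigma> = "\<lambda>x. const_subst m (min x k)"
  have "subst (const_subst m) s = subst ?\<sigma> s" "subst (const_subst m) t = subst ?\<sigma> t"
    using k by (auto intro!: subst_cong simp: subset_iff min_absorb1)
  moreover have "(subst ?\<sigma> s, subst ?\<sigma> t) \<in> (rstep (extend Sig m k) R)\<^sup>*"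
    by (rule rstep_star_subst[OF *]) (auto simp: extend_def terms_def const_subst_def)
  ultimately show "(subst (const_subst m) s, subst (const_subst m) t) \<in> (rstep (extend Sig m k) R)\<^sup>*"
    by simp
next
  have "(unconst m u, unconst m v) \<in> (rstep Sig R)\<^sup>*" if "(u, v) \<in> (rstep (extend Sig m k) R)\<^sup>*" for u v
    using that
  proof induction
    case (step v w)
    have "unconst m v = unconst m w \<or> (unconst m v, unconst m w) \<in> rstep Sig R"
      using step(2) unconst_rewrite_step[OF fresh R, where s = v and t = w] unconst_terms
      by (auto simp: rstep_def)
    with step(3) show ?case by auto
  qed simp
  moreover have "unconst m (subst (const_subst m) s) = s" "unconst m (subst (const_subst m) t) = t"
    by (rule unconst_const_subst[of Sig]; use fresh assms(3,4) in simp)+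
  ultimately show "(subst (const_subst m) s, subst (const_subst m) t) \<in> (rstep (extend Sig m k) R)\<^sup>* \<Longrightarrow>
      (s, t) \<in> (rstep Sig R)\<^sup>*"
    by metis
qed

section \<open>Codes as bounds for variables and symbols\<close>

lemma le_list_encode: "x \<in> set xs \<Longrightarrow> x \<le> list_encode xs"
proof (induction xs)
  case (Cons y ys)
  then show ?case
    using le_prod_encode_1[of y "list_encode ys"] le_prod_encode_2[of "list_encode ys" y] by auto
qed simp

lemma vars_le_enc_term: "vars t \<subseteq> {..enc_term t}"
proof (induction t)
  case (Fun f ts)
  have "x \<le> enc_term (Fun f ts)" if "t \<in> set ts" "x \<in> vars t" for x t
  proof -
    have "x \<le> enc_term t" using Fun that by auto
    also have "\<dots> \<le> list_encode (map enc_term ts)" using that by (intro le_list_encode) auto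
    also have "\<dots> \<le> pair f (list_encode (map enc_term ts))" by (rule le_prod_encode_2)
    finally show ?thesis by (simp add: sum_encode_def)
  qed
  then show ?case by auto
qed (simp add: sum_encode_def)

lemma less_enc_alphabet:
  assumes "finite Sig" "(f, n) \<in> Sig" shows "f < enc_alphabet Sig"
proof -
  have "pair f n < enc_alphabet Sig"
    unfolding enc_alphabet_def using assms by (intro less_set_encode) auto
  then show ?thesis using le_prod_encode_1[of f n] by linarith
qed

lemma ranked_alphabet_extend:
  assumes "ranked_alphabet Sig"
  shows "ranked_alphabet (extend Sig (enc_alphabet Sig) k)"
proof -
  have "f < enc_alphabet Sig" if "(f, n) \<in> Sig" for f n
    using assms less_enc_alphabet that unfolding ranked_alphabet_def by blast
  then show ?thesis
    using assms unfolding ranked_alphabet_def extend_def single_valued_def by fastforce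
qed

section \<open>The decision procedure\<close>

text \<open>Two inclusions between decoded sets, written so that the closure rules for semidecidable
  predicates apply: disjunctions with a negated membership replace implications, and
  \<open>x + y = k\<close> with existential \<open>y\<close> expresses
  \<open>x \<le> k\<close>.\<close>

definition extension_code :: "nat \<Rightarrow> nat \<Rightarrow> nat \<Rightarrow> bool" where
  "extension_code m k A \<longleftrightarrow>
    (\<forall>z<A. z \<notin> set_decode A \<or> z \<in> set_decode m \<or> (\<exists>x. z = pair (m + x) 0 \<and> (\<exists>y. x + y = k))) \<and>
    (\<forall>z<m. z \<notin> set_decode m \<or> z \<in> set_decode A) \<and>
    (\<forall>x<Suc k. pair (m + x) 0 \<in> set_decode A)"

lemma extension_code_iff:
  assumes "finite Sig"
  shows "extension_code (enc_alphabet Sig) k A \<longleftrightarrow> A = enc_alphabet (extend Sig (enc_alphabet Sig) k)"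
proof -
  define m where "m = enc_alphabet Sig"
  have dm: "set_decode m = prod_encode ` Sig"
    unfolding m_def enc_alphabet_def using assms by simp
  have fin: "finite (extend Sig m k)" using assms by (simp add: extend_def)
  have "extension_code m k A \<longleftrightarrow> set_decode A = prod_encode ` extend Sig m k"
  proof -
    have "extension_code m k A \<longleftrightarrow>
      (\<forall>z\<in>set_decode A. z \<in> set_decode m \<or> (\<exists>x\<le>k. z = pair (m + x) 0)) \<and>
      set_decode m \<subseteq> set_decode A \<and> (\<forall>x\<le>k. pair (m + x) 0 \<in> set_decode A)"
      unfolding extension_code_def le_iff_add[of _ k] less_Suc_eq_le
      using mem_set_decode_less by blast
    also have "\<dots> \<longleftrightarrow> set_decode A = prod_encode ` extend Sig m k"
      unfolding extend_def image_Un image_image dm by auto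
    finally show ?thesis .
  qed
  also have "\<dots> \<longleftrightarrow> A = set_encode (prod_encode ` extend Sig m k)"
    using fin by (metis finite_imageI set_decode_inverse set_encode_inverse)
  finally show ?thesis unfolding m_def enc_alphabet_def .
qed

definition singleton_code :: "nat \<Rightarrow> nat \<Rightarrow> bool" where
  "singleton_code t L \<longleftrightarrow> t \<in> set_decode L \<and> (\<forall>z<L. z \<notin> set_decode L \<or> z = t)"

lemma singleton_code_iff: "singleton_code t L \<longleftrightarrow> L = set_encode {t}"
proof -
  have "singleton_code t L \<longleftrightarrow> set_decode L = {t}"
    unfolding singleton_code_def using mem_set_decode_less by blast
  also have "\<dots> \<longleftrightarrow> L = set_encode {t}"
    by (metis finite.emptyI finite_insert set_decode_inverse set_encode_inverse)
  finally show ?thesis .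
qed

text \<open>Links the code \<open>z\<close> of a rule to the final states \<open>F\<close> and
  transitions \<open>D\<close> that the program produces for its grounded left-hand side, and to the
  grounded right-hand side \<open>u\<close>. The code \<open>l\<close> itself is the bound on the
  variables of the rule.\<close>

definition rule_automaton :: "nat \<Rightarrow> nat \<Rightarrow> nat \<Rightarrow> nat \<Rightarrow> nat \<Rightarrow> nat \<Rightarrow> bool" where
  "rule_automaton c m z F D u \<longleftrightarrow> (\<exists>l r t A L q. z = pair l r \<and>
    certified (const_rule m) (rel l t) \<and> certified (const_rule m) (rel r u) \<and>
    extension_code m l A \<and> singleton_code t L \<and>
    certified run_rule (ev c (cons A (cons L 0)) (pair q (pair F D))))"

text \<open>\<open>eprf_construction\<close> only asserts that some suitable automaton is output.
  Programs are deterministic, so its code is the only output, and the searches for acceptance and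
  for rejection see the same automaton.\<close>

lemma rule_automaton_correct:
  assumes c: "eprf_construction c R" and R: "trs_over Sig R" and S: "trs_over Sig S" and lr: "(l, r) \<in> S"
  obtains F \<Delta> where "finite F" "finite \<Delta>"
    "\<forall>F' D u. rule_automaton (enc_recf c) (enc_alphabet Sig) (pair (enc_term l) (enc_term r)) F' D u \<longleftrightarrow>
      F' = set_encode F \<and> D = set_encode (enc_transition ` \<Delta>) \<and>
      u = enc_term (subst (const_subst (enc_alphabet Sig)) r)"
    "(\<exists>a\<in>F. reach \<Delta> (map_trm Inl (subst (const_subst (enc_alphabet Sig)) r)) a) \<longleftrightarrow>
      (l, r) \<in> (rstep Sig R)\<^sup>*"
proof -
  define m where "m = enc_alphabet Sig"
  define Sig' where "Sig' = extend Sig m (enc_term l)"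
  define hat where "hat = subst (const_subst m)"
  have fin: "finite Sig" using R by (simp add: trs_over_def ranked_alphabet_def)
  have terms: "l \<in> terms Sig" "r \<in> terms Sig" "vars r \<subseteq> vars l"
    using S lr by (auto simp: trs_over_def)
  have vars: "vars l \<subseteq> {..enc_term l}" "vars r \<subseteq> {..enc_term l}"
    using vars_le_enc_term terms(3) by blast+
  have ground: "hat t \<in> ground_terms Sig'" if "t \<in> terms Sig" "vars t \<subseteq> {..enc_term l}" for t
    using that by (auto simp: hat_def ground_terms_def terms_def syms_subst vars_subst
        const_subst_def Sig'_def extend_def)
  have "ranked_alphabet Sig'"
    unfolding Sig'_def m_def using R by (intro ranked_alphabet_extend) (simp add: trs_over_def)
  moreover have "sign R \<subseteq> Sig'"
    using R by (fastforce simp: sign_def trs_over_def terms_def Sig'_def extend_def)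
  ultimately obtain C where C: "bta_over Sig' C" "lang Sig' C = descendants Sig' R {hat l}"
    "computes c [enc_alphabet Sig', enc_terms {hat l}] (enc_bta C)"
    using c ground[OF terms(1) vars(1)] unfolding eprf_construction_def by (metis empty_subsetI finite.emptyI finite_insert insert_subset)
  show thesis
  proof
    show "finite (finals C)" "finite (transitions C)"
      using C(1) finite_subset by (auto simp: bta_over_def)
    have *: "certified run_rule (ev (enc_recf c) (cons (enc_alphabet Sig') (cons (set_encode {enc_term (hat l)}) 0)) y)
        \<longleftrightarrow> y = enc_bta C" for y
    proof -
      have "certified run_rule (ev (enc_recf c) (cons (enc_alphabet Sig') (cons (set_encode {enc_term (hat l)}) 0)) y) \<longleftrightarrow>
        computes c [enc_alphabet Sig', set_encode {enc_term (hat l)}] y"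
        using run_iff[of c "[enc_alphabet Sig', set_encode {enc_term (hat l)}]" y] by simp
      also have "\<dots> \<longleftrightarrow> y = enc_bta C"
        using C(3) computes_deterministic unfolding enc_terms_def by auto
      finally show ?thesis .
    qed
    show "\<forall>F' D u. rule_automaton (enc_recf c) (enc_alphabet Sig) (pair (enc_term l) (enc_term r)) F' D u \<longleftrightarrow>
      F' = set_encode (finals C) \<and> D = set_encode (enc_transition ` transitions C) \<and>
      u = enc_term (subst (const_subst (enc_alphabet Sig)) r)"
      unfolding rule_automaton_def prod_encode_eq prod.inject m_def[symmetric]
      using extension_code_iff[OF fin, folded m_def] *
      by (auto simp: const_iff singleton_code_iff Sig'_def hat_def enc_bta_def)
  next
    have "(\<exists>a\<in>finals C. reach (transitions C) (map_trm Inl (hat r)) a) \<longleftrightarrow> hat r \<in> lang Sig' C"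
      using ground[OF terms(2) vars(2)] by (simp add: lang_def rewrite_steps_state_iff)
    also have "\<dots> \<longleftrightarrow> (hat l, hat r) \<in> (rstep Sig' R)\<^sup>*"
      unfolding C(2) descendants_def by simp
    also have "\<dots> \<longleftrightarrow> (l, r) \<in> (rstep Sig R)\<^sup>*"
      unfolding hat_def Sig'_def
      by (rule rstep_star_const_subst_iff) (use less_enc_alphabet[OF fin] m_def R terms vars in auto)
    finally show "(\<exists>a\<in>finals C. reach (transitions C)
        (map_trm Inl (subst (const_subst (enc_alphabet Sig)) r)) a) \<longleftrightarrow> (l, r) \<in> (rstep Sig R)\<^sup>*"
      unfolding hat_def m_def .
  qed
qed

text \<open>Isolates the computability argument, which concerns numbers only. That the two
  predicates are complementary depends on the data being valid and is left as a premise.\<close>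

lemma inclusion_search:
  "\<exists>d. \<forall>c R m S.
    ((\<exists>z. z \<in> set_decode S \<and> (\<exists>F D u. rule_automaton c m z F D u \<and> rejects F D u)) \<longleftrightarrow>
      \<not> (\<forall>z<S. z \<notin> set_decode S \<or> (\<exists>F D u. rule_automaton c m z F D u \<and> accepts F D u))) \<longrightarrow>
    computes d [c, R, m, S]
      (of_bool (\<forall>z<S. z \<notin> set_decode S \<or> (\<exists>F D u. rule_automaton c m z F D u \<and> accepts F D u)))"
proof -
  let ?\<Gamma> = "[fst, \<lambda>e. fst (snd e), \<lambda>e. fst (snd (snd e)), \<lambda>e. snd (snd (snd e))]
    :: (nat \<times> nat \<times> nat \<times> nat \<Rightarrow> nat) list"
  let ?P = "\<lambda>e. \<forall>z<snd (snd (snd e)). z \<notin> set_decode (snd (snd (snd e))) \<or>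
    (\<exists>F D u. rule_automaton (fst e) (fst (snd (snd e))) z F D u \<and> accepts F D u)"
  let ?P' = "\<lambda>e. \<exists>z. z \<in> set_decode (snd (snd (snd e))) \<and>
    (\<exists>F D u. rule_automaton (fst e) (fst (snd (snd e))) z F D u \<and> rejects F D u)"
  have P: "semidecidable ?\<Gamma> ?P"
    unfolding rule_automaton_def extension_code_def singleton_code_def
    by (intro semidecidable_intros semidecidable_run semidecidable_const semidecidable_accepts
          computable_intros;
        (intro computable_fst computable_snd)?; (rule computable_var, simp)?)
  have P': "semidecidable ?\<Gamma> ?P'"
    unfolding rule_automaton_def extension_code_def singleton_code_def
    by (intro semidecidable_intros semidecidable_run semidecidable_const semidecidable_rejects
          computable_intros;
        (intro computable_fst computable_snd)?; (rule computable_var, simp)?)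
  obtain d where d: "\<forall>e. (?P' e \<longleftrightarrow> \<not> ?P e) \<longrightarrow> computes d (map (\<lambda>g. g e) ?\<Gamma>) (of_bool (?P e))"
    using computable_search[OF P P'] by (elim exE)
  show ?thesis
    by (intro exI[of _ d] allI)
      (rule d[THEN spec, of "(c, R, m, S)" for c R m S, unfolded list.map fst_conv snd_conv])
qed

theorem mainTheorem6:
  shows "\<exists>d. \<forall>R c Sig S.
    eprf_trs R \<and> eprf_construction c R \<and> trs_over Sig R \<and> trs_over Sig S \<longrightarrow>
    computes d [enc_recf c, enc_trs R, enc_alphabet Sig, enc_trs S]
      (if (rstep Sig S)\<^sup>* \<subseteq> (rstep Sig R)\<^sup>* then 1 else 0)"
proof -
  define P where "P c m S \<longleftrightarrow> (\<forall>z<S. z \<notin> set_decode S \<or>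
    (\<exists>F D u. rule_automaton c m z F D u \<and> accepts F D u))" for c m S
  define P' where "P' c m S \<longleftrightarrow> (\<exists>z. z \<in> set_decode S \<and>
    (\<exists>F D u. rule_automaton c m z F D u \<and> rejects F D u))" for c m S
  obtain d where d: "\<And>c R m S. P' c m S \<longleftrightarrow> \<not> P c m S \<Longrightarrow> computes d [c, R, m, S] (of_bool (P c m S))"
    using inclusion_search unfolding P_def P'_def by blast
  have "computes d [enc_recf c, enc_trs R, enc_alphabet Sig, enc_trs S]
      (if (rstep Sig S)\<^sup>* \<subseteq> (rstep Sig R)\<^sup>* then 1 else 0)"
    if c: "eprf_construction c R" and R: "trs_over Sig R" and S: "trs_over Sig S" for R c Sig S
  proof -
    let ?A = "\<lambda>l r. rule_automaton (enc_recf c) (enc_alphabet Sig) (pair (enc_term l) (enc_term r))"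
    \<comment> \<open>Since \<open>F\<close>, \<open>D\<close> and \<open>u\<close> are unique for a
      rule of \<open>S\<close>, exactly one of acceptance and rejection holds for it; this yields
      the complementarity of \<open>P\<close> and \<open>P'\<close>.\<close>
    have rule: "(\<exists>F D u. ?A l r F D u \<and> accepts F D u) \<longleftrightarrow> (l, r) \<in> (rstep Sig R)\<^sup>*"
      "(\<exists>F D u. ?A l r F D u \<and> rejects F D u) \<longleftrightarrow> (l, r) \<notin> (rstep Sig R)\<^sup>*"
      if lr: "(l, r) \<in> S" for l r
    proof -
      obtain F \<Delta> where fin: "finite F" "finite \<Delta>" and A: "\<forall>F' D u. ?A l r F' D u \<longleftrightarrow>
          F' = set_encode F \<and> D = set_encode (enc_transition ` \<Delta>) \<and>
          u = enc_term (subst (const_subst (enc_alphabet Sig)) r)"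
        and reach: "(\<exists>a\<in>F. reach \<Delta> (map_trm Inl (subst (const_subst (enc_alphabet Sig)) r)) a) \<longleftrightarrow>
          (l, r) \<in> (rstep Sig R)\<^sup>*"
        by (rule rule_automaton_correct[OF c R S lr])
      show "(\<exists>F D u. ?A l r F D u \<and> accepts F D u) \<longleftrightarrow> (l, r) \<in> (rstep Sig R)\<^sup>*"
        "(\<exists>F D u. ?A l r F D u \<and> rejects F D u) \<longleftrightarrow> (l, r) \<notin> (rstep Sig R)\<^sup>*"
        unfolding A[rule_format] reach[symmetric] using accepts_rejects_iff[OF fin(2,1)] by auto
    qed
    have S': "set_decode (enc_trs S) = (\<lambda>(l, r). pair (enc_term l) (enc_term r)) ` S"
      unfolding enc_trs_def using S by (simp add: trs_over_def)
    have P: "P (enc_recf c) (enc_alphabet Sig) (enc_trs S) \<longleftrightarrow> (\<forall>(l, r)\<in>S. (l, r) \<in> (rstep Sig R)\<^sup>*)"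
    proof -
      have "P (enc_recf c) (enc_alphabet Sig) (enc_trs S) \<longleftrightarrow> (\<forall>z\<in>set_decode (enc_trs S).
          \<exists>F D u. rule_automaton (enc_recf c) (enc_alphabet Sig) z F D u \<and> accepts F D u)"
        unfolding P_def using mem_set_decode_less by blast
      also have "\<dots> \<longleftrightarrow> (\<forall>(l, r)\<in>S. (l, r) \<in> (rstep Sig R)\<^sup>*)"
        unfolding S' using rule(1) by fastforce
      finally show ?thesis .
    qed
    have "P' (enc_recf c) (enc_alphabet Sig) (enc_trs S) \<longleftrightarrow> \<not> (\<forall>(l, r)\<in>S. (l, r) \<in> (rstep Sig R)\<^sup>*)"
      unfolding P'_def S' using rule(2) by fastforce
    then show ?thesis
      using d[of "enc_recf c" "enc_alphabet Sig" "enc_trs S" "enc_trs R"]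
      unfolding P rstep_star_subset_iff[OF S] by (simp add: of_bool_def)
  qed
  then show ?thesis by blast
qed

end
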